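(* For every $n<\omega$, there exists a computable connected graph $G$ whose distance function $d_G$ is intrinsically $n$-approximable from above and such that, for every total function $f:\omega\to\omega$ with a computable $n$-approximation $g$ from above, there is some computable graph $H\cong G$ whose distance function $d_H$ satisfies $$d_H\le_{2\text{-btt}} \lim_s c\le_{1\text{-btt}} d_H,$$ where $c$ is the countdown function for $g$ with bound $n$, i.e. $c(x,0)=n$, and $c(x,s+1)=c(x,s)-1$ if $g(x,s+1)\ne g(x,s)$, while $c(x,s+1)=c(x,s)$ otherwise; and $\lim_s c$ denotes the function $x\mapsto\lim_s c(x,s)$.
   Context: A graph is computable if its domain is $\omega$ or a finite initial segment of $\omega$ and its (symmetric, irreflexive) edge relation is computable. The distance function of a connected graph gives the length of the shortest path between nodes, regarded as a function on $\omega$ via a fixed computable pairing. A computable $n$-approximation from above to $f$ is a total computable $g$ with $f(x)=\lim_s g(x,s)$, $g(x,s+1)\le g(x,s)$ for all $x,s$, and $|\{s:g(x,s)\ne g(x,s+1)\}|\le n$ for all $x$; a function is $n$-approximable from above if it has one. The distance function of $G$ is intrinsically $n$-approximable from above if for every computable graph $H\cong G$ the distance function of $H$ is $n$-approximable from above. For total $\alpha,\beta$, with $D_e$ the finite set of canonical index $e$: $\alpha\le_{k\text{-btt}}\beta$ if there are total computable $p,q$ with $|D_{p(x)}|\le k$ and $\alpha(x)=q(x,\beta\restriction D_{p(x)})$ for all $x$. *)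

theory Defs
  imports Complex_Main "HOL-Library.Nat_Bijection"
begin

section \<open>Computable functions\<close>

text \<open>
  Descriptions of partial recursive functions. No arities are recorded: a description is
  run on an argument list, and simply has no value on lists of an unsuitable length.
\<close>

datatype recf =
    Zero
  | Succ
  | Proj nat
  | Comp recf "recf list"
  | PrimRec recf recf
  | Mu recf

inductive evals :: "recf \<Rightarrow> nat list \<Rightarrow> nat \<Rightarrow> bool" where
  zero: "evals Zero xs 0"
| succ: "evals Succ [x] (Suc x)"
| proj: "i < length xs \<Longrightarrow> evals (Proj i) xs (xs ! i)"
| comp: "list_all2 (\<lambda>r y. evals r xs y) rs ys \<Longrightarrow> evals r ys z \<Longrightarrow> evals (Comp r rs) xs z"
| prim_0: "evals r xs y \<Longrightarrow> evals (PrimRec r t) (0 # xs) y"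
| prim_Suc: "evals (PrimRec r t) (m # xs) y \<Longrightarrow> evals t (m # y # xs) z
    \<Longrightarrow> evals (PrimRec r t) (Suc m # xs) z"
| mu: "evals r (m # xs) 0 \<Longrightarrow> (\<And>i. i < m \<Longrightarrow> \<exists>v. evals r (i # xs) (Suc v))
    \<Longrightarrow> evals (Mu r) xs m"

lemma evals_deterministic:
  assumes "evals r xs y" "evals r xs z"
  shows "y = z"
  using assms
proof (induction arbitrary: z rule: evals.induct)
  case (zero xs)
  then show ?case by cases simp
next
  case (succ x)
  then show ?case by cases simp
next
  case (proj i xs)
  from proj.prems show ?case by cases simp
next
  case (prim_0 r xs y t)
  from prim_0.prems show ?case by cases (simp_all add: prim_0.IH)
next
  case (comp xs rs ys r w)
  from comp.prems obtain ys' where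
    ys': "list_all2 (\<lambda>r y. evals r xs y) rs ys'" "evals r ys' z"
    by cases
  have "ys = ys'"
  proof (rule nth_equalityI)
    show "length ys = length ys'"
      using comp.IH(1) ys'(1) by (auto simp: list_all2_conv_all_nth)
    show "ys ! i = ys' ! i" if "i < length ys" for i
      using comp.IH(1) ys'(1) that by (auto simp: list_all2_conv_all_nth)
  qed
  with comp.IH(2) ys'(2) show ?case by simp
next
  case (prim_Suc r t m xs y w)
  from prim_Suc.prems obtain y' where
    "evals (PrimRec r t) (m # xs) y'" "evals t (m # y' # xs) z"
    by cases
  with prim_Suc.IH show ?case by blast
next
  case (mu r m xs)
  from mu.prems have z: "evals r (z # xs) 0 \<and> (\<forall>i<z. \<exists>v. evals r (i # xs) (Suc v))"
    by cases blast
  have "\<not> m < z" using z mu.IH(1) by blast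
  moreover have "\<not> z < m" using z mu.IH(2) by blast
  ultimately show ?case by simp
qed

definition computable1 :: "(nat \<Rightarrow> nat) \<Rightarrow> bool" where
  "computable1 f \<longleftrightarrow> (\<exists>r. \<forall>x. evals r [x] (f x))"

definition computable2 :: "(nat \<Rightarrow> nat \<Rightarrow> nat) \<Rightarrow> bool" where
  "computable2 f \<longleftrightarrow> (\<exists>r. \<forall>x y. evals r [x, y] (f x y))"


section \<open>Graphs and their distance functions\<close>

record ngraph =
  verts :: "nat set"
  edges :: "(nat \<times> nat) set"

definition is_graph :: "ngraph \<Rightarrow> bool" where
  "is_graph G \<longleftrightarrow> edges G \<subseteq> verts G \<times> verts G \<and> sym (edges G) \<and> irrefl (edges G)"

definition computable_graph :: "ngraph \<Rightarrow> bool" where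
  "computable_graph G \<longleftrightarrow>
     is_graph G \<and>
     (verts G = UNIV \<or> (\<exists>m. verts G = {..<m})) \<and>
     computable2 (\<lambda>u v. if (u, v) \<in> edges G then 1 else 0)"

definition graph_iso :: "ngraph \<Rightarrow> ngraph \<Rightarrow> bool" (infix "\<cong>\<^sub>g" 50) where
  "G \<cong>\<^sub>g H \<longleftrightarrow>
     (\<exists>h. bij_betw h (verts G) (verts H) \<and>
          (\<forall>u\<in>verts G. \<forall>v\<in>verts G. (u, v) \<in> edges G \<longleftrightarrow> (h u, h v) \<in> edges H))"

definition is_path :: "ngraph \<Rightarrow> nat \<Rightarrow> nat list \<Rightarrow> nat \<Rightarrow> bool" where
  "is_path G u xs v \<longleftrightarrow>
     xs \<noteq> [] \<and> hd xs = u \<and> last xs = v \<and> set xs \<subseteq> verts G \<and> distinct xs \<and>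
     successively (\<lambda>a b. (a, b) \<in> edges G) xs"

definition connected_graph :: "ngraph \<Rightarrow> bool" where
  "connected_graph G \<longleftrightarrow>
     verts G \<noteq> {} \<and> (\<forall>u\<in>verts G. \<forall>v\<in>verts G. \<exists>xs. is_path G u xs v)"

definition gdist :: "ngraph \<Rightarrow> nat \<Rightarrow> nat \<Rightarrow> nat" where
  "gdist G u v = (LEAST k. \<exists>xs. is_path G u xs v \<and> length xs = Suc k)"

text \<open>
  The distance function on all of \<open>\<omega>\<close>, via the Cantor pairing. If the vertex set is a
  finite initial segment, codes of pairs that are not pairs of vertices get the value 0;
  this changes only the presentation of functions that are computable anyway.
\<close>

definition dist_fun :: "ngraph \<Rightarrow> nat \<Rightarrow> nat" where
  "dist_fun G x =
     (case prod_decode x of (u, v) \<Rightarrow>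
        if u \<in> verts G \<and> v \<in> verts G then gdist G u v else 0)"


section \<open>Approximations from above\<close>

definition approx_from_above :: "nat \<Rightarrow> (nat \<Rightarrow> nat) \<Rightarrow> (nat \<Rightarrow> nat \<Rightarrow> nat) \<Rightarrow> bool" where
  "approx_from_above n f g \<longleftrightarrow>
     computable2 g \<and>
     (\<forall>x. (\<lambda>s. g x s) \<longlonglongrightarrow> f x) \<and>
     (\<forall>x s. g x (Suc s) \<le> g x s) \<and>
     (\<forall>x. finite {s. g x s \<noteq> g x (Suc s)} \<and> card {s. g x s \<noteq> g x (Suc s)} \<le> n)"

definition approximable_from_above :: "nat \<Rightarrow> (nat \<Rightarrow> nat) \<Rightarrow> bool" where
  "approximable_from_above n f \<longleftrightarrow> (\<exists>g. approx_from_above n f g)"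

definition intrinsically_approximable_from_above :: "nat \<Rightarrow> ngraph \<Rightarrow> bool" where
  "intrinsically_approximable_from_above n G \<longleftrightarrow>
     (\<forall>H. computable_graph H \<and> H \<cong>\<^sub>g G \<longrightarrow> approximable_from_above n (dist_fun H))"

text \<open>
  The subtraction never truncates when \<open>g x\<close> changes at most \<open>n\<close> times, which is the only
  case of interest.
\<close>

primrec countdown :: "nat \<Rightarrow> (nat \<Rightarrow> nat \<Rightarrow> nat) \<Rightarrow> nat \<Rightarrow> nat \<Rightarrow> nat" where
  "countdown n g x 0 = n"
| "countdown n g x (Suc s) =
     (if g x (Suc s) \<noteq> g x s then countdown n g x s - 1 else countdown n g x s)"


section \<open>Bounded truth-table reducibility\<close>

text \<open>
  \<open>set_decode e\<close> is the finite set with canonical index \<open>e\<close>. A finite restriction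
  \<open>\<beta>\<restriction>D\<close> is handed to a computable function as the canonical index of its graph, that is,
  of the finite set of codes of the pairs \<open>(a, \<beta> a)\<close> with \<open>a \<in> D\<close>.
\<close>

definition restr_code :: "(nat \<Rightarrow> nat) \<Rightarrow> nat set \<Rightarrow> nat" where
  "restr_code \<beta> D = set_encode ((\<lambda>a. prod_encode (a, \<beta> a)) ` D)"

definition btt_reducible :: "nat \<Rightarrow> (nat \<Rightarrow> nat) \<Rightarrow> (nat \<Rightarrow> nat) \<Rightarrow> bool" where
  "btt_reducible k \<alpha> \<beta> \<longleftrightarrow>
     (\<exists>p q. computable1 p \<and> computable2 q \<and>
        (\<forall>x. card (set_decode (p x)) \<le> k \<and>
             \<alpha> x = q x (restr_code \<beta> (set_decode (p x)))))"

end

theory Submission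
  imports Defs "HOL-Library.Infinite_Set" "HOL-Combinatorics.Transposition"
begin

text \<open>
  Write \<open>m = n + 2\<close>. In a computable graph of diameter at most \<open>m\<close> the distances 0 and 1 are decidable
  and the remaining \<open>n + 1\<close> possible distances can be approximated from above with \<open>n\<close> changes, so
  such a graph is intrinsically \<open>n\<close>-approximable.

  Any graph can be given diameter \<open>m\<close> without altering its distances below \<open>m\<close>, by attaching to each
  vertex a path of length about \<open>m / 2\<close> that leads to a common hub. We do this to a disjoint union of
  components, one for each counter: a component starts as a path with vertices of kinds \<open>0, \<dots>, m\<close>, and
  when its counter drops for the \<open>e\<close>-th time, vertices of kind \<open>m + e\<close> are added that are adjacent
  to kinds \<open>0\<close> and \<open>e + 2\<close>. The distance between the ends of the path is then 2 plus the limit of the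
  counter. Every kind that occurs in a component occurs there infinitely often, and every component
  type occurs infinitely often; hence all graphs obtained in this way are isomorphic, and they are so
  homogeneous that a distance depends only on a finite amount of data: the kinds, the positions on the
  attached paths and the limits of the (at most two) counters involved.
\<close>

section \<open>Computable functions\<close>

text \<open>
  Expressions in \<open>k\<close> variables, given by an environment \<open>e\<close>. Binders shift the environment as with
  de Bruijn indices, so that the introduction rules below apply by unification.
\<close>

definition cf :: "nat \<Rightarrow> ((nat \<Rightarrow> nat) \<Rightarrow> nat) \<Rightarrow> bool" where
  "cf k F \<longleftrightarrow> (\<exists>r. \<forall>xs. length xs = k \<longrightarrow> evals r xs (F (nth xs)))"

lemma computable1_iff_cf: "computable1 f \<longleftrightarrow> cf 1 (\<lambda>e. f (e 0))"
  unfolding computable1_def cf_def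
  by (metis One_nat_def length_0_conv length_Cons length_Suc_conv nth_Cons_0)

lemma computable2_iff_cf: "computable2 f \<longleftrightarrow> cf 2 (\<lambda>e. f (e 0) (e 1))"
proof
  assume "computable2 f"
  then obtain r where r: "\<And>x y. evals r [x, y] (f x y)"
    unfolding computable2_def by blast
  have "evals r xs (f (xs ! 0) (xs ! 1))" if "length xs = 2" for xs
  proof -
    from that obtain x y where "xs = [x, y]"
      by (auto simp: numeral_2_eq_2 length_Suc_conv)
    with r show ?thesis by simp
  qed
  then show "cf 2 (\<lambda>e. f (e 0) (e 1))"
    unfolding cf_def by blast
next
  assume "cf 2 (\<lambda>e. f (e 0) (e 1))"
  then obtain r where r: "\<And>xs. length xs = 2 \<Longrightarrow> evals r xs (f (xs ! 0) (xs ! 1))"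
    unfolding cf_def by blast
  have "evals r [x, y] (f x y)" for x y
    using r[of "[x, y]"] by simp
  then show "computable2 f"
    unfolding computable2_def by blast
qed

named_theorems cf_intros

lemma cf_var [cf_intros]: "i < k \<Longrightarrow> cf k (\<lambda>e. e i)"
  unfolding cf_def using evals.proj by blast

lemma cf_comp1:
  assumes "computable1 f" "cf k F"
  shows "cf k (\<lambda>e. f (F e))"
proof -
  obtain r s where "\<And>x. evals r [x] (f x)" "\<And>xs. length xs = k \<Longrightarrow> evals s xs (F (nth xs))"
    using assms unfolding computable1_def cf_def by blast
  then have "evals (Comp r [s]) xs (f (F (nth xs)))" if "length xs = k" for xs
    using that by (intro evals.comp[where ys = "[F (nth xs)]"]) auto
  then show ?thesis unfolding cf_def by blast
qed

lemma cf_comp2: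
  assumes "computable2 f" "cf k F" "cf k G"
  shows "cf k (\<lambda>e. f (F e) (G e))"
proof -
  obtain r s t where "\<And>x y. evals r [x, y] (f x y)"
    "\<And>xs. length xs = k \<Longrightarrow> evals s xs (F (nth xs))"
    "\<And>xs. length xs = k \<Longrightarrow> evals t xs (G (nth xs))"
    using assms unfolding computable2_def cf_def by blast
  then have "evals (Comp r [s, t]) xs (f (F (nth xs)) (G (nth xs)))" if "length xs = k" for xs
    using that by (intro evals.comp[where ys = "[F (nth xs), G (nth xs)]"]) auto
  then show ?thesis unfolding cf_def by blast
qed

lemma cf_Suc [cf_intros]: "cf k F \<Longrightarrow> cf k (\<lambda>e. Suc (F e))"
  by (rule cf_comp1) (auto simp: computable1_def intro: evals.succ)

lemma cf_const [cf_intros]: "cf k (\<lambda>e. c)"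
proof (induction c)
  case 0
  then show ?case unfolding cf_def using evals.zero by blast
qed (rule cf_Suc)

lemma cf_rec:
  assumes "cf k A" "cf (Suc (Suc k)) (\<lambda>e. S (e 0) (e 1) (\<lambda>i. e (Suc (Suc i))))" "cf k N"
  shows "cf k (\<lambda>e. rec_nat (A e) (\<lambda>m y. S m y e) (N e))"
proof -
  obtain a s t where a: "\<And>xs. length xs = k \<Longrightarrow> evals a xs (A (nth xs))"
    and s: "\<And>xs. length xs = Suc (Suc k) \<Longrightarrow> evals s xs (S (xs ! 0) (xs ! 1) (\<lambda>i. xs ! Suc (Suc i)))"
    and t: "\<And>xs. length xs = k \<Longrightarrow> evals t xs (N (nth xs))"
    using assms unfolding cf_def by blast
  have rec: "evals (PrimRec a s) (j # xs) (rec_nat (A (nth xs)) (\<lambda>m y. S m y (nth xs)) j)"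
    if "length xs = k" for xs j
  proof (induction j)
    case 0
    then show ?case using a that by (auto intro: evals.prim_0)
  next
    case (Suc j)
    show ?case
      using s[of "j # rec_nat (A (nth xs)) (\<lambda>m y. S m y (nth xs)) j # xs"] that
      by (auto intro!: evals.prim_Suc[OF Suc])
  qed
  \<comment> \<open>The projections copy the whole environment, so that the recursion keeps
    \<open>xs\<close> as its parameters.\<close>
  have projs: "list_all2 (\<lambda>r y. evals r xs y) (map Proj [0..<k]) xs" if "length xs = k" for xs
    using that by (auto simp: list_all2_conv_all_nth intro: evals.proj)
  have "evals (Comp (PrimRec a s) (t # map Proj [0..<k])) xs
      (rec_nat (A (nth xs)) (\<lambda>m y. S m y (nth xs)) (N (nth xs)))" if "length xs = k" for xs
    using rec t projs that by (intro evals.comp[where ys = "N (nth xs) # xs"]) auto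
  then show ?thesis unfolding cf_def by blast
qed

lemma cf_add [cf_intros]:
  assumes "cf k F" "cf k G" shows "cf k (\<lambda>e. F e + G e)"
proof -
  have eq: "x + y = rec_nat x (\<lambda>m z. Suc z) y" for x y :: nat
    by (induction y) auto
  show ?thesis
    unfolding eq by (intro cf_rec assms cf_intros) simp
qed

lemma cf_sum [cf_intros]:
  assumes "cf k N" "cf (Suc k) (\<lambda>e. F (e 0) (\<lambda>i. e (Suc i)))"
  shows "cf k (\<lambda>e. \<Sum>i<N e. F i e)"
proof -
  have eq: "(\<Sum>i<n. F i e) = rec_nat 0 (\<lambda>m z. z + F m e) n" for n e
    by (induction n) auto
  obtain r where r: "\<And>xs. length xs = Suc k \<Longrightarrow> evals r xs (F (xs ! 0) (\<lambda>i. xs ! Suc i))"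
    using assms(2) unfolding cf_def by blast
  \<comment> \<open>In the recursion the environment holds the index, the accumulator and then the
    parameters. \<open>F\<close> expects index and parameters only, so position 1 is
    skipped.\<close>
  have "evals (Comp r (Proj 0 # map (\<lambda>i. Proj (Suc (Suc i))) [0..<k])) xs
      (F (xs ! 0) (\<lambda>i. xs ! Suc (Suc i)))" if "length xs = Suc (Suc k)" for xs
  proof -
    from that obtain x y ys where xs: "xs = x # y # ys" "length ys = k"
      by (auto simp: length_Suc_conv)
    have "list_all2 (\<lambda>r y. evals r xs y) (map (\<lambda>i. Proj (Suc (Suc i))) [0..<k]) ys"
      using xs by (auto simp: list_all2_conv_all_nth intro: evals.proj[where xs = "x # y # ys", of "Suc (Suc _)", simplified])
    moreover have "evals (Proj 0) xs x"
      using evals.proj[of 0 xs] xs by simp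
    ultimately show ?thesis
      using r[of "x # ys"] xs by (intro evals.comp[where ys = "x # ys"]) auto
  qed
  then have "cf (Suc (Suc k)) (\<lambda>e. F (e 0) (\<lambda>i. e (Suc (Suc i))))"
    unfolding cf_def by blast
  then show ?thesis
    unfolding eq by (intro cf_rec cf_add assms cf_const cf_var) simp_all
qed

lemma cf_mult [cf_intros]:
  assumes "cf k F" "cf k G" shows "cf k (\<lambda>e. F e * G e)"
proof -
  have times: "computable2 (*)"
  proof -
    have eq: "x * y = (\<Sum>i<x. y)" for x y :: nat by simp
    show ?thesis unfolding computable2_iff_cf eq by (intro cf_intros) simp_all
  qed
  show ?thesis by (rule cf_comp2[OF times assms])
qed

lemma cf_diff [cf_intros]:
  assumes "cf k F" "cf k G" shows "cf k (\<lambda>e. F e - G e)"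
proof -
  have pred: "computable1 (\<lambda>x. x - 1)"
  proof -
    have eq: "x - 1 = rec_nat 0 (\<lambda>m z. m) x" for x :: nat
      by (cases x) auto
    show ?thesis
      unfolding computable1_iff_cf eq by (intro cf_rec cf_intros) simp_all
  qed
  have eq: "x - y = rec_nat x (\<lambda>m z. z - 1) y" for x y :: nat
    by (induction y) auto
  show ?thesis
    unfolding eq[of "F _"] by (intro cf_rec assms cf_comp1[OF pred] cf_intros) simp
qed

lemma cf_power [cf_intros]:
  assumes "cf k F" "cf k G" shows "cf k (\<lambda>e. F e ^ G e)"
proof -
  have pow: "computable2 (\<lambda>x y. x ^ y)"
  proof -
    have eq: "x ^ y = rec_nat 1 (\<lambda>m z. x * z) y" for x y :: nat
      by (induction y) auto
    show ?thesis
      unfolding computable2_iff_cf eq by (intro cf_rec cf_intros) simp_all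
  qed
  show ?thesis by (rule cf_comp2[OF pow assms])
qed

section \<open>Decidable predicates, division and pairing\<close>

definition cfp :: "nat \<Rightarrow> ((nat \<Rightarrow> nat) \<Rightarrow> bool) \<Rightarrow> bool" where
  "cfp k P \<longleftrightarrow> cf k (\<lambda>e. of_bool (P e))"

lemma cf_of_bool [cf_intros]: "cfp k P \<Longrightarrow> cf k (\<lambda>e. of_bool (P e))"
  by (simp add: cfp_def)

lemma cfp_not [cf_intros]:
  assumes "cfp k P" shows "cfp k (\<lambda>e. \<not> P e)"
proof -
  have eq: "of_bool (\<not> p) = 1 - (of_bool p :: nat)" for p by simp
  show ?thesis
    unfolding cfp_def eq by (intro cf_intros assms)
qed

lemma cfp_conj [cf_intros]:
  assumes "cfp k P" "cfp k Q" shows "cfp k (\<lambda>e. P e \<and> Q e)"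
  unfolding cfp_def of_bool_conj by (intro cf_intros assms)

lemma cfp_disj [cf_intros]:
  assumes "cfp k P" "cfp k Q" shows "cfp k (\<lambda>e. P e \<or> Q e)"
proof -
  have eq: "P e \<or> Q e \<longleftrightarrow> \<not> (\<not> P e \<and> \<not> Q e)" for e by simp
  show ?thesis unfolding eq by (intro cf_intros assms)
qed

lemma cfp_le [cf_intros]:
  assumes "cf k F" "cf k G" shows "cfp k (\<lambda>e. F e \<le> G e)"
proof -
  have eq: "of_bool (x \<le> y) = 1 - (x - y)" for x y :: nat by auto
  show ?thesis unfolding cfp_def eq by (intro cf_intros assms)
qed

lemma cfp_less [cf_intros]:
  assumes "cf k F" "cf k G" shows "cfp k (\<lambda>e. F e < G e)"
  unfolding not_le[symmetric] by (intro cf_intros assms)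

lemma cfp_eq [cf_intros]:
  assumes "cf k F" "cf k G" shows "cfp k (\<lambda>e. F e = G e)"
  unfolding eq_iff by (intro cf_intros assms)

lemma cfp_const [cf_intros]: "cfp k (\<lambda>e. p)"
  unfolding cfp_def by (rule cf_const)

lemma cf_if [cf_intros]:
  assumes "cfp k P" "cf k F" "cf k G"
  shows "cf k (\<lambda>e. if P e then F e else G e)"
proof -
  have eq: "(if p then x else y) = of_bool p * x + of_bool (\<not> p) * y" for p and x y :: nat
    by simp
  show ?thesis unfolding eq by (intro cf_intros assms)
qed

lemma cf_min [cf_intros]: "cf k F \<Longrightarrow> cf k G \<Longrightarrow> cf k (\<lambda>e. min (F e) (G e))"
  unfolding min_def by (intro cf_intros)

lemma cfp_ex_less [cf_intros]:
  assumes "cf k N" "cfp (Suc k) (\<lambda>e. P (e 0) (\<lambda>i. e (Suc i)))"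
  shows "cfp k (\<lambda>e. \<exists>i<N e. P i e)"
proof -
  have eq: "(\<exists>i<N e. P i e) \<longleftrightarrow> 0 < (\<Sum>i<N e. of_bool (P i e) :: nat)" for e
    by (auto simp: sum_eq_0_iff simp flip: neq0_conv)
  show ?thesis unfolding eq by (intro cf_intros assms)
qed

lemma cf_div [cf_intros]:
  assumes "cf k F" "cf k G" shows "cf k (\<lambda>e. F e div G e)"
proof -
  have "computable2 (div)"
  proof -
    \<comment> \<open>The quotient counts the positive multiples of \<open>y\<close> up to
      \<open>x\<close>; the value at \<open>y = 0\<close> follows the convention for
      \<open>div\<close>.\<close>
    have eq: "x div y = (if y = 0 then 0 else \<Sum>i<x. of_bool (Suc i * y \<le> x))" for x y :: nat
    proof (cases "y = 0")
      case False
      have "i < x div y \<longleftrightarrow> Suc i * y \<le> x" for i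
        using False by (metis Suc_le_eq less_eq_div_iff_mult_less_eq neq0_conv)
      moreover have "x div y \<le> x" by simp
      ultimately have "{i. i < x \<and> Suc i * y \<le> x} = {..<x div y}"
        by (auto simp del: mult_Suc intro: less_le_trans)
      then show ?thesis
        using False by (simp add: of_bool_def sum.If_cases Int_def del: mult_Suc)
    qed simp
    show ?thesis unfolding computable2_iff_cf eq by (intro cf_intros) simp_all
  qed
  from cf_comp2[OF this assms] show ?thesis .
qed

lemma cf_mod [cf_intros]:
  assumes "cf k F" "cf k G" shows "cf k (\<lambda>e. F e mod G e)"
  unfolding modulo_nat_def by (intro cf_intros assms)

lemma cfp_even [cf_intros]: "cf k F \<Longrightarrow> cfp k (\<lambda>e. even (F e))"
  unfolding even_iff_mod_2_eq_zero by (intro cf_intros)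

lemma cf_prod_encode [cf_intros]: "cf k F \<Longrightarrow> cf k G \<Longrightarrow> cf k (\<lambda>e. prod_encode (F e, G e))"
  unfolding prod_encode_def triangle_def split_conv by (intro cf_intros)

text \<open>Both components of a pair are at most its code, so decoding is a bounded search, written
  here as a sum in which only the pair coded by \<open>z\<close> survives.\<close>

lemma sum_prod_decode:
  fixes h :: "nat \<Rightarrow> nat \<Rightarrow> nat"
  shows "(\<Sum>a<Suc z. \<Sum>b<Suc z. h a b * of_bool (prod_encode (a, b) = z)) =
    h (fst (prod_decode z)) (snd (prod_decode z))"
proof -
  obtain a b where z: "z = prod_encode (a, b)"
    by (metis prod_decode_inverse surj_pair)
  have le: "a < Suc z" "b < Suc z"
    using z le_prod_encode_1[of a b] le_prod_encode_2[of b a] by auto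
  have "(\<Sum>a<Suc z. \<Sum>b<Suc z. h a b * of_bool (prod_encode (a, b) = z)) =
      (\<Sum>(a', b')\<in>{..<Suc z} \<times> {..<Suc z}. h a' b' * of_bool (prod_encode (a', b') = z))"
    by (rule sum.cartesian_product)
  also have "\<dots> = (\<Sum>(a', b')\<in>{(a, b)}. h a' b' * of_bool (prod_encode (a', b') = z))"
    using le z by (intro sum.mono_neutral_right) auto
  finally show ?thesis by (simp add: z)
qed

lemma cf_fst_prod_decode [cf_intros]:
  assumes "cf k F" shows "cf k (\<lambda>e. fst (prod_decode (F e)))"
proof -
  have "computable1 (\<lambda>z. fst (prod_decode z))"
    unfolding computable1_iff_cf sum_prod_decode[of "\<lambda>a b. a", symmetric]
    by (intro cf_intros) simp_all
  from cf_comp1[OF this assms] show ?thesis .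
qed

lemma cf_snd_prod_decode [cf_intros]:
  assumes "cf k F" shows "cf k (\<lambda>e. snd (prod_decode (F e)))"
proof -
  have "computable1 (\<lambda>z. snd (prod_decode z))"
    unfolding computable1_iff_cf sum_prod_decode[of "\<lambda>a b. b", symmetric]
    by (intro cf_intros) simp_all
  from cf_comp1[OF this assms] show ?thesis .
qed

lemma cf_finite_sum:
  fixes F :: "'a \<Rightarrow> (nat \<Rightarrow> nat) \<Rightarrow> nat"
  assumes "finite I" "\<And>i. i \<in> I \<Longrightarrow> cf k (F i)"
  shows "cf k (\<lambda>e. \<Sum>i\<in>I. F i e)"
  using assms
proof (induction I rule: finite_induct)
  case empty
  then show ?case by (simp add: cf_const)
next
  case (insert i I)
  then show ?case by (simp add: cf_add)
qed

text \<open>Finitely many values of an arbitrary \<open>T\<close> are constants that equality tests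
  can select. This later hard-wires a table of distances into a computable function.\<close>

lemma cf_finite_table:
  assumes "cf k F"
  shows "cf k (\<lambda>e. if F e < N then T (F e) else 0)"
proof -
  have eq: "(if x < N then T x else 0) = (\<Sum>j<N. of_bool (x = j) * T j)" for x
    by (simp add: of_bool_def if_distrib[of "\<lambda>c. c * _"] sum.delta cong: if_cong)
  show ?thesis
    unfolding eq by (intro cf_finite_sum cf_intros assms) simp
qed

section \<open>Distances and isomorphisms\<close>

lemma is_path_relpow:
  assumes "is_path G u xs v"
  shows "(u, v) \<in> edges G ^^ (length xs - 1)"
proof -
  have "(hd xs, last xs) \<in> edges G ^^ (length xs - 1)"
    if "xs \<noteq> []" "successively (\<lambda>a b. (a, b) \<in> edges G) xs" for xs
    using that
  proof (induction xs rule: induct_list012)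
    case (3 x y zs)
    then have "(y, last (y # zs)) \<in> edges G ^^ length zs" by simp
    moreover have "(x, y) \<in> edges G" using 3 by simp
    ultimately have "(x, last (y # zs)) \<in> edges G ^^ Suc (length zs)"
      by (rule relpow_Suc_I2[rotated])
    then show ?case by simp
  qed auto
  with assms show ?thesis unfolding is_path_def by blast
qed

lemma relpow_walk:
  assumes "(u, v) \<in> R ^^ k"
  obtains w where "w 0 = u" "w k = v" "\<And>i. i < k \<Longrightarrow> (w i, w (Suc i)) \<in> R"
  using assms unfolding relpow_fun_conv by blast

text \<open>A shortest walk repeats no vertex, since the part between two visits could be cut out.\<close>

lemma shortest_walk_is_path:
  assumes "edges G \<subseteq> verts G \<times> verts G" "u \<in> verts G"
    and k: "(u, v) \<in> edges G ^^ k" and min: "\<And>j. j < k \<Longrightarrow> (u, v) \<notin> edges G ^^ j"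
  shows "\<exists>xs. is_path G u xs v \<and> length xs = Suc k"
proof -
  obtain w where w: "w 0 = u" "w k = v" "\<And>i. i < k \<Longrightarrow> (w i, w (Suc i)) \<in> edges G"
    using k by (rule relpow_walk) blast
  have seg: "(w i, w (i + j)) \<in> edges G ^^ j" if "i + j \<le> k" for i j
    using that
  proof (induction j)
    case (Suc j)
    then show ?case using w(3)[of "i + j"] by (simp add: relcomp.relcompI)
  qed simp
  have neq: "w i \<noteq> w j" if "i < j" "j \<le> k" for i j
  proof
    assume eq: "w i = w j"
    have "(u, w i) \<in> edges G ^^ i" "(w j, v) \<in> edges G ^^ (k - j)"
      using seg[of 0 i] seg[of j "k - j"] w that by auto
    with eq have "(u, v) \<in> edges G ^^ (i + (k - j))"
      unfolding relpow_add by auto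
    with min[of "i + (k - j)"] that show False by simp
  qed
  have inj: "inj_on w {..<Suc k}"
    using neq by (intro linorder_inj_onI) (auto simp: less_Suc_eq_le)
  let ?xs = "map w [0..<Suc k]"
  have verts: "w i \<in> verts G" if "i \<le> k" for i
    using that w(1) w(3)[of "i - 1"] assms(1,2) by (cases i) auto
  have "successively (\<lambda>a b. (a, b) \<in> edges G) ?xs"
    using w(3) by (auto simp: successively_conv_nth simp del: upt_Suc)
  moreover have "distinct ?xs"
    using inj by (simp add: distinct_map lessThan_atLeast0 del: upt_Suc)
  moreover have "hd ?xs = u" "last ?xs = v" "set ?xs \<subseteq> verts G"
    using w(1,2) verts by (auto simp: hd_map last_map less_Suc_eq_le simp del: upt_Suc)
  ultimately show ?thesis
    unfolding is_path_def by (intro exI[of _ ?xs]) simp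
qed

text \<open>Walks, unlike paths, are closed under concatenation and homomorphic images, so distances
  are handled through relation powers from here on.\<close>

lemma gdist_eq_Least:
  assumes "edges G \<subseteq> verts G \<times> verts G" "u \<in> verts G"
  shows "gdist G u v = (LEAST k. (u, v) \<in> edges G ^^ k)"
proof (cases "\<exists>k. (u, v) \<in> edges G ^^ k")
  case True
  define d where "d = (LEAST k. (u, v) \<in> edges G ^^ k)"
  have d: "(u, v) \<in> edges G ^^ d" "\<And>j. (u, v) \<in> edges G ^^ j \<Longrightarrow> d \<le> j"
    using True unfolding d_def by (auto intro: LeastI_ex Least_le)
  have "gdist G u v = d"
    unfolding gdist_def
  proof (rule Least_equality)
    show "\<exists>xs. is_path G u xs v \<and> length xs = Suc d"
      using assms d by (intro shortest_walk_is_path) (auto simp: leD)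
    show "d \<le> k" if "\<exists>xs. is_path G u xs v \<and> length xs = Suc k" for k
      using that d(2) is_path_relpow by fastforce
  qed
  then show ?thesis by (simp add: d_def)
next
  \<comment> \<open>Without any walk both predicates are empty, so both \<open>LEAST\<close> terms
    have the same unspecified value.\<close>
  case False
  then have "(\<lambda>k. \<exists>xs. is_path G u xs v \<and> length xs = Suc k) = (\<lambda>k. (u, v) \<in> edges G ^^ k)"
    using is_path_relpow by fastforce
  then show ?thesis by (simp add: gdist_def)
qed

lemma gdist_le:
  assumes "edges G \<subseteq> verts G \<times> verts G" "u \<in> verts G" "(u, v) \<in> edges G ^^ k"
  shows "gdist G u v \<le> k"
  unfolding gdist_eq_Least[OF assms(1,2)] using assms(3) by (rule Least_le)

lemma relpow_gdist:
  assumes "edges G \<subseteq> verts G \<times> verts G" "u \<in> verts G" "(u, v) \<in> edges G ^^ k"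
  shows "(u, v) \<in> edges G ^^ gdist G u v"
  unfolding gdist_eq_Least[OF assms(1,2)] using assms(3) by (rule LeastI)

definition diam_le :: "nat \<Rightarrow> ngraph \<Rightarrow> bool" where
  "diam_le m G \<longleftrightarrow> (\<forall>u\<in>verts G. \<forall>v\<in>verts G. \<exists>k\<le>m. (u, v) \<in> edges G ^^ k)"

lemma diam_le_connected:
  assumes "edges G \<subseteq> verts G \<times> verts G" "verts G \<noteq> {}" "diam_le m G"
  shows "connected_graph G"
  unfolding connected_graph_def
proof (intro conjI ballI)
  fix u v assume uv: "u \<in> verts G" "v \<in> verts G"
  then have ex: "\<exists>k. (u, v) \<in> edges G ^^ k"
    using assms(3) unfolding diam_le_def by blast
  show "\<exists>xs. is_path G u xs v"
    using shortest_walk_is_path[OF assms(1) uv(1) LeastI_ex[OF ex]] not_less_Least by blast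
qed fact

lemma edges_relpow_hom:
  assumes "\<And>a b. (a, b) \<in> E \<Longrightarrow> (h a, h b) \<in> E'" "(u, v) \<in> E ^^ k"
  shows "(h u, h v) \<in> E' ^^ k"
  using assms(2)
proof (induction k arbitrary: v)
  case (Suc k)
  then obtain w where "(u, w) \<in> E ^^ k" "(w, v) \<in> E" by auto
  with Suc.IH assms(1) show ?case by (meson relpow_Suc_I)
qed simp

lemma graph_iso_sym:
  assumes "G \<cong>\<^sub>g H" shows "H \<cong>\<^sub>g G"
proof -
  obtain h where h: "bij_betw h (verts G) (verts H)"
    "\<forall>u\<in>verts G. \<forall>v\<in>verts G. (u, v) \<in> edges G \<longleftrightarrow> (h u, h v) \<in> edges H"
    using assms unfolding graph_iso_def by blast
  let ?i = "inv_into (verts G) h"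
  have "bij_betw ?i (verts H) (verts G)"
    using h(1) by (rule bij_betw_inv_into)
  moreover have "?i u \<in> verts G" "h (?i u) = u" if "u \<in> verts H" for u
    using that h(1) by (auto simp: bij_betw_def inv_into_into f_inv_into_f)
  ultimately show ?thesis
    unfolding graph_iso_def using h(2) by (intro exI[of _ ?i]) auto
qed

lemma diam_le_iso:
  assumes "G \<cong>\<^sub>g H" "edges G \<subseteq> verts G \<times> verts G" "diam_le m G"
  shows "diam_le m H"
proof -
  obtain h where h: "bij_betw h (verts G) (verts H)"
    "\<And>u v. u \<in> verts G \<Longrightarrow> v \<in> verts G \<Longrightarrow> (u, v) \<in> edges G \<longleftrightarrow> (h u, h v) \<in> edges H"
    using assms unfolding graph_iso_def by blast
  have hom: "(h a, h b) \<in> edges H" if "(a, b) \<in> edges G" for a b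
    using that h(2) assms(2) by blast
  have "\<exists>k\<le>m. (h u, h v) \<in> edges H ^^ k" if "u \<in> verts G" "v \<in> verts G" for u v
  proof -
    obtain k where k: "k \<le> m" "(u, v) \<in> edges G ^^ k"
      using assms(3) \<open>u \<in> verts G\<close> \<open>v \<in> verts G\<close> unfolding diam_le_def by blast
    have "(h u, h v) \<in> edges H ^^ k"
      by (rule edges_relpow_hom[OF _ k(2)]) (rule hom)
    with k(1) show ?thesis by blast
  qed
  moreover have "verts H = h ` verts G"
    using h(1) by (simp add: bij_betw_def)
  ultimately show ?thesis
    unfolding diam_le_def by simp
qed

lemma gdist_automorphism:
  assumes "verts G = UNIV" "bij h"
    and iff: "\<And>a b. (h a, h b) \<in> edges G \<longleftrightarrow> (a, b) \<in> edges G"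
  shows "gdist G (h u) (h v) = gdist G u v"
proof -
  have "(h u, h v) \<in> edges G ^^ k \<longleftrightarrow> (u, v) \<in> edges G ^^ k" for k
  proof
    assume "(h u, h v) \<in> edges G ^^ k"
    then have "(inv h (h u), inv h (h v)) \<in> edges G ^^ k"
      by (rule edges_relpow_hom[rotated])
        (metis assms(2) bij_inv_eq_iff iff)
    then show "(u, v) \<in> edges G ^^ k"
      using assms(2) by (simp add: bij_is_inj)
  qed (use iff in \<open>blast intro: edges_relpow_hom\<close>)
  with assms(1) show ?thesis by (simp add: gdist_eq_Least)
qed

section \<open>Graphs of bounded diameter\<close>

text \<open>This describes walks of at most \<open>k\<close> steps whose vertices other than the
  last lie below \<open>s\<close>. The bound makes the search finite at each stage, and every walk
  meets it eventually.\<close>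

primrec reach :: "(nat \<times> nat) set \<Rightarrow> nat \<Rightarrow> nat \<Rightarrow> nat \<Rightarrow> nat \<Rightarrow> bool" where
  "reach E 0 u v s \<longleftrightarrow> u = v"
| "reach E (Suc k) u v s \<longleftrightarrow> reach E k u v s \<or> (\<exists>w<s. reach E k u w s \<and> (w, v) \<in> E)"

lemma reach_mono: "reach E k u v s \<Longrightarrow> s \<le> t \<Longrightarrow> reach E k u v t"
  by (induction k arbitrary: v) (auto dest: less_le_trans)

lemma reach_relpow: "reach E k u v s \<Longrightarrow> \<exists>j\<le>k. (u, v) \<in> E ^^ j"
proof (induction k arbitrary: v)
  case (Suc k)
  then show ?case
  proof (cases "reach E k u v s")
    case False
    with Suc.prems obtain w where "reach E k u w s" "(w, v) \<in> E" by auto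
    with Suc.IH[of w] show ?thesis by (meson Suc_le_mono relpow_Suc_I)
  qed (use Suc.IH[of v] le_SucI in blast)
qed simp

lemma eventually_reach:
  assumes "(u, v) \<in> E ^^ j" "j \<le> k"
  shows "eventually (\<lambda>s. reach E k u v s) sequentially"
  using assms
proof (induction k arbitrary: v j)
  case (Suc k)
  show ?case
  proof (cases "j \<le> k")
    case True
    from Suc.IH[OF Suc.prems(1) this] show ?thesis
      by (rule eventually_mono) simp
  next
    case False
    with Suc.prems obtain w where w: "(u, w) \<in> E ^^ k" "(w, v) \<in> E"
      by (metis le_SucE relpow_Suc_E)
    show ?thesis
      using Suc.IH[OF w(1) order_refl] eventually_gt_at_top[of w]
      by eventually_elim (use w in auto)
  qed
qed (simp add: always_eventually)

lemma cfp_reach: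
  assumes "computable2 (\<lambda>u v. if (u, v) \<in> E then 1 else 0)"
  shows "cf k U \<Longrightarrow> cf k V \<Longrightarrow> cf k S \<Longrightarrow> cfp k (\<lambda>e. reach E j (U e) (V e) (S e))"
proof (induction j arbitrary: k U V S)
  case 0
  then show ?case by (simp add: cfp_eq)
next
  case (Suc j)
  have E: "cfp k (\<lambda>e. (A e, B e) \<in> E)" if "cf k A" "cf k B" for k A B
    using cf_comp2[OF assms that] by (simp add: cfp_def of_bool_def)
  have "computable2 (\<lambda>x y. of_bool (reach E j (fst (prod_decode x)) (snd (prod_decode x)) y))"
    unfolding computable2_iff_cf by (intro cf_of_bool Suc.IH cf_intros) simp_all
  from cf_comp2[OF this]
  have IH: "cfp k (\<lambda>e. reach E j (A e) (B e) (C e))" if "cf k A" "cf k B" "cf k C" for k A B C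
    using that by (intro Suc.IH)
  \<comment> \<open>The quantifier is first treated as a function of a code of the pair and of the
    stage. Substituting \<open>U\<close>, \<open>V\<close> and \<open>S\<close> afterwards avoids
    shifting them under the binder.\<close>
  have "computable2 (\<lambda>x s. of_bool (\<exists>w<s. reach E j (fst (prod_decode x)) w s \<and>
      (w, snd (prod_decode x)) \<in> E))"
    unfolding computable2_iff_cf by (intro cf_intros IH E) simp_all
  from cf_comp2[OF this cf_prod_encode[OF Suc.prems(1,2)] Suc.prems(3)]
  have "cfp k (\<lambda>e. \<exists>w<S e. reach E j (U e) w (S e) \<and> (w, V e) \<in> E)"
    by (simp add: cfp_def)
  with IH Suc.prems show ?case by (simp add: cfp_disj)
qed

text \<open>A decreasing \<open>g\<close> takes different values at different stages of change, each
  in \<open>{l<..l + n}\<close>.\<close>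

lemma card_decreasing_changes:
  fixes g :: "nat \<Rightarrow> nat"
  assumes dec: "\<And>s. g (Suc s) \<le> g s" and bounds: "\<And>s. l \<le> g s" "g 0 \<le> l + n"
  shows "finite {s. g s \<noteq> g (Suc s)} \<and> card {s. g s \<noteq> g (Suc s)} \<le> n"
proof -
  let ?S = "{s. g s \<noteq> g (Suc s)}"
  have anti: "g t \<le> g s" if "s \<le> t" for s t
    using lift_Suc_antimono_le[of g s t, OF dec that] .
  have less: "g t < g s" if "s < t" "s \<in> ?S" for s t
    using that anti[of "Suc s" t] dec[of s] by simp
  have "g x \<noteq> g y" if "x \<in> ?S" "y \<in> ?S" "x < y \<or> y < x" for x y
    using that less[of x y] less[of y x] by linarith
  then have inj: "inj_on g ?S"
    unfolding inj_on_def by (metis nat_neq_iff)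
  have "l < g s \<and> g s \<le> l + n" if "s \<in> ?S" for s
    using less[of s "Suc s"] that bounds(1)[of "Suc s"] anti[of 0 s] bounds(2) by simp
  then have sub: "g ` ?S \<subseteq> {l<..l + n}"
    by auto
  show ?thesis
    using inj_on_finite[OF inj sub] card_inj_on_le[OF inj sub] by simp
qed

text \<open>
  Distances 0 and 1 can be recognised computably, and all others lie among the \<open>n + 1\<close>
  values \<open>2, \<dots>, n + 2\<close>.
\<close>

lemma diam_le_approximable:
  assumes H: "computable_graph H" "verts H = UNIV" and diam: "diam_le (n + 2) H"
  shows "approximable_from_above n (dist_fun H)"
proof -
  let ?E = "edges H"
  have comp: "computable2 (\<lambda>u v. if (u, v) \<in> ?E then 1 else 0)"
    using H(1) by (simp add: computable_graph_def)
  \<comment> \<open>For distinct non-adjacent vertices, each \<open>k\<close> from 2 to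
    \<open>n + 1\<close> counts until a walk of length at most \<open>k\<close> is found. In the
    limit the \<open>k\<close> below the distance \<open>d\<close> are left, which gives
    \<open>2 + (d - 2)\<close>.\<close>
  define A where "A u v s = (if u = v then 0 else if (u, v) \<in> ?E then 1 else
    2 + (\<Sum>k\<in>{2..<n + 2}. of_bool (\<not> reach ?E k u v s)) :: nat)" for u v s
  define g where "g x = A (fst (prod_decode x)) (snd (prod_decode x))" for x
  have E: "cfp k (\<lambda>e. (A e, B e) \<in> ?E)" if "cf k A" "cf k B" for k A B
    using cf_comp2[OF comp that] by (simp add: cfp_def of_bool_def)
  have "computable2 g"
    unfolding computable2_iff_cf g_def A_def
    by (intro cf_intros E cf_finite_sum cfp_reach comp) simp_all
  moreover have "(\<lambda>s. g x s) \<longlonglongrightarrow> dist_fun H x" for x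
  proof -
    obtain u v where x: "prod_decode x = (u, v)" by fastforce
    define d where "d = gdist H u v"
    obtain k where k: "k \<le> n + 2" "(u, v) \<in> ?E ^^ k"
      using diam H(2) unfolding diam_le_def by blast
    have sub: "?E \<subseteq> verts H \<times> verts H" using H(2) by simp
    have d: "(u, v) \<in> ?E ^^ d" "d \<le> n + 2" "\<And>j. (u, v) \<in> ?E ^^ j \<Longrightarrow> d \<le> j"
      using relpow_gdist[OF sub _ k(2)] gdist_le[OF sub, of u v] k H(2)
      unfolding d_def by (auto intro: order_trans)
    have ev: "eventually (\<lambda>s. \<forall>k\<in>{2..<n + 2}. d \<le> k \<longrightarrow> reach ?E k u v s) sequentially"
      unfolding eventually_ball_finite_distrib[OF finite_atLeastLessThan]
      using eventually_reach[OF d(1)] by (auto intro: always_eventually)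
    have "eventually (\<lambda>s. A u v s = d) sequentially"
      using ev
    proof eventually_elim
      case (elim s)
      have iff: "reach ?E k u v s \<longleftrightarrow> d \<le> k" if "k \<in> {2..<n + 2}" for k
        using that elim reach_relpow[of ?E k u v s] d(3) order_trans by blast
      consider "u = v" | "u \<noteq> v" "(u, v) \<in> ?E" | "u \<noteq> v" "(u, v) \<notin> ?E" by blast
      then show ?case
      proof cases
        case 1
        then show ?thesis using d(3)[of 0] by (simp add: A_def)
      next
        case 2
        then have "d \<le> 1" "d \<noteq> 0" using d(1) d(3)[of 1] by (auto intro!: Nat.gr0I)
        with 2 show ?thesis by (simp add: A_def)
      next
        case 3
        then have d2: "2 \<le> d"
          using d(1) by (cases d; cases "d - 1") auto
        have "(\<Sum>k\<in>{2..<n + 2}. of_bool (\<not> reach ?E k u v s) :: nat) =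
            (\<Sum>k\<in>{2..<n + 2}. of_bool (k < d))"
          using iff by (intro sum.cong) auto
        also have "\<dots> = card {2..<d}"
        proof -
          have "{2..<n + 2} \<inter> {k. k < d} = {2..<d}" using d(2) by auto
          then show ?thesis by (simp add: of_bool_def sum.If_cases del: sum.op_ivl_Suc)
        qed
        finally show ?thesis using 3 d2 by (simp add: A_def)
      qed
    qed
    then show ?thesis
      using x H(2) by (auto simp: g_def dist_fun_def d_def intro: tendsto_eventually)
  qed
  moreover have dec: "g x (Suc s) \<le> g x s" for x s
    unfolding g_def A_def
    by (auto intro!: sum_mono simp: of_bool_def dest: reach_mono[OF _ le_SucI[OF order_refl]]
        simp del: sum.op_ivl_Suc)
  moreover have "finite {s. g x s \<noteq> g x (Suc s)} \<and> card {s. g x s \<noteq> g x (Suc s)} \<le> n" for x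
  proof -
    obtain u v where x: "prod_decode x = (u, v)" by fastforce
    define l :: nat where "l = (if u = v then 0 else if (u, v) \<in> ?E then 1 else 2)"
    have sum: "(\<Sum>k\<in>{2..<n + 2}. of_bool (P k) :: nat) \<le> n" for P
      using sum_bounded_above[of "{2..<n + 2}" "\<lambda>k. of_bool (P k) :: nat" 1]
      by (simp del: sum.op_ivl_Suc)
    have "l \<le> g x s" "g x s \<le> l + n" for s
      using sum[of "\<lambda>k. \<not> reach ?E k u v s"]
      by (simp_all add: g_def A_def l_def x del: sum.op_ivl_Suc)
    with dec show ?thesis by (intro card_decreasing_changes)
  qed
  ultimately have "approx_from_above n (dist_fun H) g"
    unfolding approx_from_above_def by blast
  then show ?thesis
    unfolding approximable_from_above_def by blast
qed

section \<open>The graphs\<close>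

text \<open>
  Vertex 0 is the hub. Every other vertex lies on an arm: the arm attached to \<open>b\<close> has the vertices
  \<open>vert n b i\<close> with \<open>i < arm_len n\<close>, and \<open>i = 0\<close> is the vertex of the original component. The number
  \<open>b\<close> codes \<open>(a, (s, j))\<close>, where \<open>a\<close> is the component and the kind of \<open>b\<close> is \<open>j\<close>, cut off at the largest
  kind that is present at stage \<open>s\<close>.
\<close>

definition row :: "nat \<Rightarrow> nat" where
  "row b = fst (prod_decode b)"

text \<open>With \<open>m = n + 2\<close> and \<open>e = n - d s\<close>, the number of drops of a
  countdown by stage \<open>s\<close>, the bound is \<open>m + e\<close>. A code consults the
  counter only at the stage it carries, which keeps adjacency decidable.\<close>

definition pos_kind :: "nat \<Rightarrow> (nat \<Rightarrow> nat) \<Rightarrow> nat \<Rightarrow> nat" where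
  "pos_kind n d t = min (snd (prod_decode t)) (2 * n + 2 - d (fst (prod_decode t)))"

definition kind :: "nat \<Rightarrow> (nat \<Rightarrow> nat \<Rightarrow> nat) \<Rightarrow> nat \<Rightarrow> nat" where
  "kind n c b = pos_kind n (c (row b)) (snd (prod_decode b))"

text \<open>The first alternative is the path on the kinds \<open>0\<close> to
  \<open>m = n + 2\<close>. The second joins a shortcut kind \<open>k' = m + e\<close> to
  \<open>0\<close> and to \<open>k' - n = e + 2\<close>; going from \<open>0\<close> to
  \<open>m\<close> over it takes \<open>2 + (m - (e + 2)) = 2 + (n - e)\<close> steps.\<close>

definition kind_adj :: "nat \<Rightarrow> nat \<Rightarrow> nat \<Rightarrow> bool" where
  "kind_adj n k k' \<longleftrightarrow>
     k \<le> n + 2 \<and> (k' = Suc k \<and> k' \<le> n + 2 \<or> n + 2 < k' \<and> (k = 0 \<or> k' = k + n))"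

text \<open>Half of \<open>m = n + 2\<close>, rounded up: the way between the bases of two arms then
  has length \<open>m\<close>, over the hub for even \<open>n\<close> and over an edge between tips
  for odd \<open>n\<close>.\<close>

definition arm_len :: "nat \<Rightarrow> nat" where
  "arm_len n = (n + 3) div 2"

definition lev :: "nat \<Rightarrow> nat \<Rightarrow> nat" where
  "lev n v = (v - 1) mod arm_len n"

definition base :: "nat \<Rightarrow> nat \<Rightarrow> nat" where
  "base n v = (v - 1) div arm_len n"

definition vert :: "nat \<Rightarrow> nat \<Rightarrow> nat \<Rightarrow> nat" where
  "vert n b i = Suc (b * arm_len n + i)"

text \<open>
  For even \<open>n\<close> the distance between two arms is realised through the hub; for odd \<open>n\<close> it has to be
  odd, and the ends of the arms are made pairwise adjacent.
\<close>

definition arc :: "nat \<Rightarrow> (nat \<Rightarrow> nat \<Rightarrow> nat) \<Rightarrow> nat \<Rightarrow> nat \<Rightarrow> bool" where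
  "arc n c u v \<longleftrightarrow>
     u = 0 \<and> v \<noteq> 0 \<and> Suc (lev n v) = arm_len n \<or>
     u \<noteq> 0 \<and> v \<noteq> 0 \<and>
       (odd n \<and> Suc (lev n u) = arm_len n \<and> Suc (lev n v) = arm_len n \<and> base n u \<noteq> base n v \<or>
        base n u = base n v \<and> lev n v = Suc (lev n u) \<or>
        lev n u = 0 \<and> lev n v = 0 \<and> row (base n u) = row (base n v) \<and>
          kind_adj n (kind n c (base n u)) (kind n c (base n v)))"

definition arm_graph :: "nat \<Rightarrow> (nat \<Rightarrow> nat \<Rightarrow> nat) \<Rightarrow> ngraph" where
  "arm_graph n c = \<lparr>verts = UNIV, edges = {(u, v). arc n c u v \<or> arc n c v u}\<rparr>"

lemma arm_graph_simps [simp]: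
  "verts (arm_graph n c) = UNIV"
  "(u, v) \<in> edges (arm_graph n c) \<longleftrightarrow> arc n c u v \<or> arc n c v u"
  by (simp_all add: arm_graph_def)

lemma arm_len_pos [simp]: "0 < arm_len n"
  by (simp add: arm_len_def)

lemma lev_less [simp]: "lev n v < arm_len n"
  by (simp add: lev_def)

lemma vert_simps [simp]:
  "vert n b i \<noteq> 0" "0 \<noteq> vert n b i"
  "i < arm_len n \<Longrightarrow> lev n (vert n b i) = i"
  "i < arm_len n \<Longrightarrow> base n (vert n b i) = b"
  by (simp_all add: vert_def lev_def base_def)

lemma vert_base_lev: "v \<noteq> 0 \<Longrightarrow> vert n (base n v) (lev n v) = v"
  by (simp add: vert_def lev_def base_def)

lemma vert_cases:
  obtains "v = 0" | b i where "v = vert n b i" "i < arm_len n"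
  using vert_base_lev[of v n] lev_less[of n v] by metis

lemma kind_adj_irrefl: "\<not> kind_adj n k k"
  by (auto simp: kind_adj_def)

lemma arc_irrefl: "\<not> arc n c v v"
  by (auto simp: arc_def kind_adj_irrefl)

lemma computable_arm_graph:
  assumes "computable2 c"
  shows "computable_graph (arm_graph n c)"
proof -
  have "is_graph (arm_graph n c)"
    by (auto simp: is_graph_def sym_def irrefl_def arc_irrefl)
  moreover have "cfp k (\<lambda>e. arc n c (U e) (V e))" if UV: "cf k U" "cf k V" for k U V
    unfolding arc_def lev_def base_def kind_def pos_kind_def row_def kind_adj_def
    by (intro cf_intros UV cf_comp2[OF assms])
  then have "computable2 (\<lambda>u v. if (u, v) \<in> edges (arm_graph n c) then 1 else 0)"
    unfolding computable2_iff_cf arm_graph_simps by (intro cf_intros) (simp_all add: cf_var)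
  ultimately show ?thesis
    by (simp add: computable_graph_def)
qed

section \<open>Walks along the arms and the diameter\<close>

lemma relpow_arm_down:
  assumes "i \<le> j" "j < arm_len n"
  shows "(vert n b i, vert n b j) \<in> edges (arm_graph n c) ^^ (j - i)"
  using assms
proof (induction j)
  case (Suc j)
  show ?case
  proof (cases "i = Suc j")
    case False
    with Suc have "(vert n b i, vert n b j) \<in> edges (arm_graph n c) ^^ (j - i)" by simp
    moreover have "(vert n b j, vert n b (Suc j)) \<in> edges (arm_graph n c)"
      using Suc.prems by (simp add: arc_def)
    ultimately have "(vert n b i, vert n b (Suc j)) \<in> edges (arm_graph n c) ^^ Suc (j - i)"
      by (rule relpow_Suc_I)
    then show ?thesis using False Suc.prems by (simp add: Suc_diff_le)
  qed simp
qed simp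

lemma relpow_sym:
  assumes "sym E" "(u, v) \<in> E ^^ k" shows "(v, u) \<in> E ^^ k"
  using assms(2)
proof (induction k arbitrary: v)
  case (Suc k)
  then obtain w where "(u, w) \<in> E ^^ k" "(w, v) \<in> E" by auto
  with Suc.IH have "(w, u) \<in> E ^^ k" "(v, w) \<in> E" using assms(1) by (auto dest: symD)
  then show ?case by (rule relpow_Suc_I2[rotated])
qed simp

lemma relpow_trans: "(u, v) \<in> E ^^ j \<Longrightarrow> (v, w) \<in> E ^^ k \<Longrightarrow> (u, w) \<in> E ^^ (j + k)"
  unfolding relpow_add by blast

lemma diam_arm_graph: "diam_le (n + 2) (arm_graph n c)"
proof -
  let ?E = "edges (arm_graph n c)" and ?L = "arm_len n"
  have sym: "sym ?E" by (auto simp: sym_def)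
  note rsym = relpow_sym[OF sym]
  have tip: "(vert n b i, vert n b (?L - 1)) \<in> ?E ^^ (?L - 1 - i)" if "i < ?L" for b i
    using that by (intro relpow_arm_down) auto
  have hub: "(vert n b i, 0) \<in> ?E ^^ (?L - i)" if "i < ?L" for b i
  proof -
    have "(vert n b (?L - 1), 0) \<in> ?E" by (simp add: arc_def)
    from relpow_Suc_I[OF tip[OF that] this] show ?thesis
      using that by (simp add: Suc_diff_Suc)
  qed
  have L: "n + 2 = 2 * ?L - of_bool (odd n)"
    unfolding arm_len_def by (cases "even n") (auto elim!: evenE oddE)
  have small: "?L \<le> n + 2" by (simp add: arm_len_def)
  have "\<exists>k\<le>n + 2. (u, v) \<in> ?E ^^ k" for u v
  proof (cases u rule: vert_cases[where n = n])
    case u: 1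
    show ?thesis
    proof (cases v rule: vert_cases[where n = n])
      case 1
      with u show ?thesis by (intro exI[of _ 0]) simp
    next
      case (2 b i)
      with u rsym[OF hub] small show ?thesis by (intro exI[of _ "?L - i"]) simp
    qed
  next
    case u: (2 b i)
    show ?thesis
    proof (cases v rule: vert_cases[where n = n])
      case 1
      with u hub small show ?thesis by (intro exI[of _ "?L - i"]) simp
    next
      case v: (2 b' i')
      consider "b = b'" | "b \<noteq> b'" "even n" | "b \<noteq> b'" "odd n" by blast
      then show ?thesis
      proof cases
        case 1
        then show ?thesis
          using u v small relpow_arm_down[of i i' n b c] rsym[OF relpow_arm_down[of i' i n b c]]
          by (intro exI[of _ "max i i' - min i i'"]) (auto simp: max_def min_def)
      next
        case 2
        have "(u, v) \<in> ?E ^^ (?L - i + (?L - i'))"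
          unfolding u v by (intro relpow_trans[OF hub rsym[OF hub]] u v)
        with L 2 show ?thesis by (intro exI[of _ "?L - i + (?L - i')"]) simp
      next
        case 3
        then have "(vert n b (?L - 1), vert n b' (?L - 1)) \<in> ?E"
          by (simp add: arc_def)
        from relpow_trans[OF relpow_Suc_I[OF tip[OF u(2)] this] rsym[OF tip[OF v(2)]]]
        have "(u, v) \<in> ?E ^^ (Suc (?L - 1 - i) + (?L - 1 - i'))"
          unfolding u v .
        with L 3 show ?thesis
          by (intro exI[of _ "Suc (?L - 1 - i) + (?L - 1 - i')"]) simp
      qed
    qed
  qed
  then show ?thesis by (simp add: diam_le_def)
qed

section \<open>Isomorphisms between the graphs\<close>

definition lift_base :: "nat \<Rightarrow> (nat \<Rightarrow> nat) \<Rightarrow> nat \<Rightarrow> nat" where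
  "lift_base n \<beta> v = (if v = 0 then 0 else vert n (\<beta> (base n v)) (lev n v))"

lemma lift_base_simps [simp]:
  "lift_base n \<beta> 0 = 0" "lift_base n \<beta> v = 0 \<longleftrightarrow> v = 0"
  "v \<noteq> 0 \<Longrightarrow> base n (lift_base n \<beta> v) = \<beta> (base n v)"
  "lev n (lift_base n \<beta> v) = lev n v"
  by (simp_all add: lift_base_def)

lemma bij_lift_base:
  assumes "bij \<beta>" shows "bij (lift_base n \<beta>)"
proof (rule o_bij[where g = "lift_base n (inv \<beta>)"])
  show "lift_base n (inv \<beta>) \<circ> lift_base n \<beta> = id"
    using assms by (auto simp: lift_base_def vert_base_lev bij_is_inj)
  show "lift_base n \<beta> \<circ> lift_base n (inv \<beta>) = id"
    using assms by (auto simp: lift_base_def vert_base_lev bij_is_surj surj_f_inv_f)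
qed

text \<open>\<open>arc\<close> uses bases only through their identity, their kinds and whether they
  share a row, while the lift fixes the hub and keeps levels.\<close>

lemma arc_lift_base:
  assumes "bij \<beta>" "\<And>x y. row (\<beta> x) = row (\<beta> y) \<longleftrightarrow> row x = row y"
    and "\<And>x. kind n c' (\<beta> x) = kind n c x"
  shows "arc n c' (lift_base n \<beta> u) (lift_base n \<beta> v) \<longleftrightarrow> arc n c u v"
proof (cases "u = 0 \<or> v = 0")
  case False
  have "\<beta> x = \<beta> y \<longleftrightarrow> x = y" for x y
    using assms(1) by (simp add: bij_is_inj inj_eq)
  with False show ?thesis by (simp add: arc_def assms(2,3))
qed (auto simp: arc_def)

section \<open>Bijections that respect labels\<close>

lemma bij_enum_infinite:
  fixes S T :: "nat set"
  assumes "infinite S" "infinite T"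
  shows "\<exists>f. bij_betw f S T"
  using bij_betw_trans[OF bij_betw_inv_into[OF bij_enumerate[OF assms(1)]] bij_enumerate[OF assms(2)]]
  by blast

text \<open>Infinite sets of naturals are equinumerous, so the fibres over each label are matched
  separately and the bijections glued.\<close>

lemma relabelling_bij:
  fixes f g :: "nat \<Rightarrow> nat"
  assumes "\<And>k. {x. f x = k} = {} \<and> {x. g x = k} = {} \<or> infinite {x. f x = k} \<and> infinite {x. g x = k}"
  shows "\<exists>\<tau>. bij \<tau> \<and> (\<forall>x. g (\<tau> x) = f x)"
proof -
  have "\<exists>t. bij_betw t {x. f x = k} {x. g x = k}" for k
    using assms[of k] bij_enum_infinite by (metis bij_betw_empty1 bij_betw_id)
  then obtain t where t: "\<And>k. bij_betw (t k) {x. f x = k} {x. g x = k}" by metis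
  define \<tau> where "\<tau> x = t (f x) x" for x
  have g: "g (\<tau> x) = f x" for x
    using bij_betwE[OF t[of "f x"]] by (simp add: \<tau>_def)
  have "inj \<tau>"
  proof (rule injI)
    fix x y assume eq: "\<tau> x = \<tau> y"
    then have fxy: "f x = f y" using g by metis
    with eq show "x = y"
      using bij_betw_imp_inj_on[OF t[of "f x"]] by (auto simp: \<tau>_def inj_on_def)
  qed
  moreover have "\<exists>x. \<tau> x = y" for y
  proof -
    have "y \<in> t (g y) ` {x. f x = g y}"
      using bij_betw_imp_surj_on[OF t[of "g y"]] by simp
    then obtain x where "y = t (g y) x" "f x = g y" by auto
    then have "\<tau> x = y" by (simp add: \<tau>_def)
    then show ?thesis ..
  qed
  then have "surj \<tau>" by (metis surjI surj_def)
  ultimately show ?thesis using g by (auto simp: bij_def)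
qed

lemma label_preserving_bij:
  assumes "f x = f x'" "f y = f y'" "x = y \<longleftrightarrow> x' = y'"
  shows "\<exists>\<rho>. bij \<rho> \<and> (\<forall>z. f (\<rho> z) = f z) \<and> \<rho> x = x' \<and> \<rho> y = y'"
proof -
  let ?r = "transpose x x'"
  \<comment> \<open>The outer transposition sends the image of \<open>y\<close> to \<open>y'\<close>
    and fixes \<open>x'\<close>: by the third assumption \<open>x'\<close> is either different from
    both points that it swaps or equal to both.\<close>
  let ?\<rho> = "transpose (?r y) y' \<circ> ?r"
  have fr: "f (transpose p q z) = f z" if "f p = f q" for p q z
    using that by (auto simp: transpose_def)
  have "f (?\<rho> z) = f z" for z
    using assms(1,2) by (simp add: fr)
  moreover have "bij ?\<rho>" by (intro bij_comp bij_transpose)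
  moreover have "?\<rho> x = x'" "?\<rho> y = y'"
    using assms(3) by (auto simp: transpose_def)
  ultimately show ?thesis by blast
qed


text \<open>Codes \<open>(s, k)\<close> from stages where the counter has settled show each kind up
  to the final bound. The counter never falls below its limit, so no larger kind appears.\<close>

lemma infinite_kind_fiber:
  fixes C :: nat
  assumes "\<And>s. C \<le> d s" "eventually (\<lambda>s. d s = C) sequentially" "C \<le> n"
  shows "if k \<le> 2 * n + 2 - C then infinite {t. pos_kind n d t = k} else {t. pos_kind n d t = k} = {}"
proof (cases "k \<le> 2 * n + 2 - C")
  case True
  obtain s0 where s0: "\<And>s. s0 \<le> s \<Longrightarrow> d s = C"
    using assms(2) unfolding eventually_sequentially by blast
  have "inj_on (\<lambda>s. prod_encode (s, k)) {s0..}"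
    by (auto simp: inj_on_def)
  then have "infinite ((\<lambda>s. prod_encode (s, k)) ` {s0..})"
    by (simp add: finite_image_iff infinite_Ici)
  moreover have "(\<lambda>s. prod_encode (s, k)) ` {s0..} \<subseteq> {t. pos_kind n d t = k}"
    using s0 True by (auto simp: pos_kind_def)
  ultimately show ?thesis using True by (auto dest: finite_subset)
next
  case False
  have "pos_kind n d t \<le> 2 * n + 2 - C" for t
    unfolding pos_kind_def using assms(1) by (auto intro: min.coboundedI2 diff_le_mono2)
  with False show ?thesis by auto
qed

text \<open>Having infinitely many rows for every limit is what allows any two such families to be
  matched row by row.\<close>

definition counters :: "nat \<Rightarrow> (nat \<Rightarrow> nat \<Rightarrow> nat) \<Rightarrow> (nat \<Rightarrow> nat) \<Rightarrow> bool" where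
  "counters n c C \<longleftrightarrow>
     (\<forall>a s. C a \<le> c a s) \<and> (\<forall>a. eventually (\<lambda>s. c a s = C a) sequentially) \<and>
     (\<forall>a s. c a s \<le> n) \<and> (\<forall>k\<le>n. infinite {a. C a = k})"

lemma countersD:
  assumes "counters n c C"
  shows "C a \<le> c a s" "eventually (\<lambda>s. c a s = C a) sequentially" "C a \<le> n"
    "c a s \<le> n" "k \<le> n \<Longrightarrow> infinite {a. C a = k}"
  using assms unfolding counters_def by (blast intro: order_trans)+

text \<open>Rows with equal limits contain the same kinds, each infinitely often, even if their
  counters drop at different stages. So their codes can be matched kind by kind.\<close>

lemma base_bij_of_row_bij:
  assumes c: "counters n c C" and c': "counters n c' C'"
    and \<sigma>: "bij \<sigma>" "\<And>a. C' (\<sigma> a) = C a"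
  shows "\<exists>\<beta>. bij \<beta> \<and> (\<forall>x. row (\<beta> x) = \<sigma> (row x) \<and> kind n c' (\<beta> x) = kind n c x)"
proof -
  have "\<exists>\<tau>. bij \<tau> \<and> (\<forall>t. pos_kind n (c' (\<sigma> a)) (\<tau> t) = pos_kind n (c a) t)" for a
  proof (rule relabelling_bij)
    fix k
    show "{t. pos_kind n (c a) t = k} = {} \<and> {t. pos_kind n (c' (\<sigma> a)) t = k} = {} \<or>
        infinite {t. pos_kind n (c a) t = k} \<and> infinite {t. pos_kind n (c' (\<sigma> a)) t = k}"
      using infinite_kind_fiber[OF countersD(1-3)[OF c], where k = k and a1 = a]
        infinite_kind_fiber[OF countersD(1-3)[OF c'], where k = k and a1 = "\<sigma> a"]
      by (simp only: \<sigma>(2)) presburger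
  qed
  then obtain \<tau> where \<tau>: "\<And>a. bij (\<tau> a)" "\<And>a t. pos_kind n (c' (\<sigma> a)) (\<tau> a t) = pos_kind n (c a) t"
    by metis
  define \<beta> where "\<beta> x = prod_encode (\<sigma> (row x), \<tau> (row x) (snd (prod_decode x)))" for x
  have row: "row (\<beta> x) = \<sigma> (row x)" for x
    by (simp add: \<beta>_def row_def)
  have "\<beta> x = \<beta> y \<longleftrightarrow> x = y" for x y
  proof
    assume eq: "\<beta> x = \<beta> y"
    then have "row x = row y"
      using row \<sigma>(1) by (metis bij_is_inj inj_eq)
    with eq have "fst (prod_decode x) = fst (prod_decode y)"
      "snd (prod_decode x) = snd (prod_decode y)"
      using \<tau>(1) by (auto simp: \<beta>_def bij_is_inj inj_eq row_def)
    then have "prod_decode x = prod_decode y" by (rule prod_eqI)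
    then show "x = y" by simp
  qed simp
  then have "inj \<beta>" by (simp add: inj_def)
  moreover have "\<beta> (prod_encode (inv \<sigma> (row y), inv (\<tau> (inv \<sigma> (row y))) (snd (prod_decode y)))) = y" for y
    using \<sigma>(1) \<tau>(1) by (simp add: \<beta>_def row_def bij_is_surj surj_f_inv_f)
  then have "surj \<beta>" by (rule surjI)
  moreover have "kind n c' (\<beta> x) = kind n c x" for x
    unfolding kind_def row by (simp add: \<beta>_def \<tau>(2))
  ultimately show ?thesis using row by (auto simp: bij_def)
qed

lemma counters_iso:
  assumes c: "counters n c C" and c': "counters n c' C'"
  shows "arm_graph n c \<cong>\<^sub>g arm_graph n c'"
proof -
  have "\<exists>\<sigma>. bij \<sigma> \<and> (\<forall>a. C' (\<sigma> a) = C a)"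
  proof (rule relabelling_bij)
    fix k
    show "{a. C a = k} = {} \<and> {a. C' a = k} = {} \<or> infinite {a. C a = k} \<and> infinite {a. C' a = k}"
      using countersD(3,5)[OF c] countersD(3,5)[OF c'] by (cases "k \<le> n") auto
  qed
  then obtain \<sigma> where \<sigma>: "bij \<sigma>" "\<And>a. C' (\<sigma> a) = C a" by blast
  obtain \<beta> where \<beta>: "bij \<beta>" "\<And>x. row (\<beta> x) = \<sigma> (row x)" "\<And>x. kind n c' (\<beta> x) = kind n c x"
    using base_bij_of_row_bij[OF c c' \<sigma>] by blast
  have "row (\<beta> x) = row (\<beta> y) \<longleftrightarrow> row x = row y" for x y
    using \<sigma>(1) by (simp add: \<beta>(2) bij_is_inj inj_eq)
  from arc_lift_base[OF \<beta>(1) this \<beta>(3)] bij_lift_base[OF \<beta>(1)]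
  show ?thesis
    unfolding graph_iso_def by (intro exI[of _ "lift_base n \<beta>"]) simp
qed

text \<open>Permuting rows of equal limit brings \<open>x\<close> and \<open>y\<close> into the
  right rows with the right kinds. A second permutation, within rows and kinds, then moves them to
  \<open>x'\<close> and \<open>y'\<close>.\<close>

lemma gdist_homogeneous:
  assumes c: "counters n c C"
    and x: "C (row x) = C (row x')" "kind n c x = kind n c x'"
    and y: "C (row y) = C (row y')" "kind n c y = kind n c y'"
    and xy: "row x = row y \<longleftrightarrow> row x' = row y'" "x = y \<longleftrightarrow> x' = y'"
  obtains \<beta> where "\<beta> x = x'" "\<beta> y = y'"
    "\<And>u v. gdist (arm_graph n c) (lift_base n \<beta> u) (lift_base n \<beta> v) = gdist (arm_graph n c) u v"
proof -
  obtain \<sigma> where \<sigma>: "bij \<sigma>" "\<And>a. C (\<sigma> a) = C a" "\<sigma> (row x) = row x'" "\<sigma> (row y) = row y'"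
    using label_preserving_bij[of C "row x" "row x'" "row y" "row y'"] x y xy by blast
  obtain \<beta>0 where \<beta>0: "bij \<beta>0" "\<And>z. row (\<beta>0 z) = \<sigma> (row z)" "\<And>z. kind n c (\<beta>0 z) = kind n c z"
    using base_bij_of_row_bij[OF c c \<sigma>(1,2)] by blast
  obtain \<rho> where \<rho>: "bij \<rho>" "\<And>z. (row (\<rho> z), kind n c (\<rho> z)) = (row z, kind n c z)"
    "\<rho> (\<beta>0 x) = x'" "\<rho> (\<beta>0 y) = y'"
    using label_preserving_bij[of "\<lambda>z. (row z, kind n c z)" "\<beta>0 x" x' "\<beta>0 y" y'] \<beta>0 \<sigma> x y xy
    by (auto simp: bij_is_inj inj_eq)
  let ?\<beta> = "\<rho> \<circ> \<beta>0"
  have bij: "bij ?\<beta>" using \<beta>0 \<rho> by (intro bij_comp)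
  have "row (?\<beta> a) = row (?\<beta> b) \<longleftrightarrow> row a = row b" "kind n c (?\<beta> a) = kind n c a" for a b
    using \<rho>(2) \<beta>0 \<sigma>(1) by (simp_all add: bij_is_inj inj_eq)
  from arc_lift_base[OF bij this]
  have "gdist (arm_graph n c) (lift_base n ?\<beta> u) (lift_base n ?\<beta> v) = gdist (arm_graph n c) u v" for u v
    by (intro gdist_automorphism bij_lift_base bij) simp_all
  with \<rho>(3,4) that[of ?\<beta>] show ?thesis by simp
qed

section \<open>The distance that encodes a counter\<close>

definition arm_end :: "nat \<Rightarrow> nat \<Rightarrow> nat \<Rightarrow> nat" where
  "arm_end n k a = vert n (prod_encode (a, prod_encode (0, k))) 0"

lemma relpow_potential:
  fixes \<phi> :: "'a \<Rightarrow> nat"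
  assumes "\<And>a b. (a, b) \<in> E \<Longrightarrow> \<phi> b \<le> Suc (\<phi> a)" "(u, v) \<in> E ^^ k"
  shows "\<phi> v \<le> \<phi> u + k"
  using assms(2)
proof (induction k arbitrary: v)
  case (Suc k)
  then obtain w where "(u, w) \<in> E ^^ k" "(w, v) \<in> E" by auto
  with Suc.IH assms(1) show ?case by fastforce
qed simp

lemma gdist_arm_ends:
  assumes c: "counters n c C"
  shows "gdist (arm_graph n c) (arm_end n 0 a) (arm_end n (n + 2) a) = 2 + C a"
proof -
  let ?G = "arm_graph n c" and ?L = "arm_len n" and ?m = "n + 2"
  let ?x = "arm_end n 0 a" and ?y = "arm_end n ?m a"
  \<comment> \<open>\<open>?m + e\<close> will be the largest kind in row \<open>a\<close>.\<close>
  define e where "e = n - C a"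
  have e: "e \<le> n" "C a = n - e" using countersD(3)[OF c, of a] by (auto simp: e_def)
  define bs where "bs s k = prod_encode (a, prod_encode (s, k))" for s k
  have bs: "row (bs s k) = a" "kind n c (bs s k) = min k (2 * n + 2 - c a s)" for s k
    by (simp_all add: bs_def row_def kind_def pos_kind_def)
  obtain s0 where s0: "c a s0 = C a"
    using eventually_happens[OF countersD(2)[OF c, of a]] by auto
  have kind_low: "kind n c (bs s k) = k" if "k \<le> ?m" for s k
    using that countersD(4)[OF c, of a s] by (simp add: bs)
  have adj: "(vert n b 0, vert n b' 0) \<in> edges ?G"
    if "row b = row b'" "kind_adj n (kind n c b) (kind n c b')" for b b'
    using that by (simp add: arc_def)
  have adj': "(vert n b' 0, vert n b 0) \<in> edges ?G"
    if "row b = row b'" "kind_adj n (kind n c b) (kind n c b')" for b b'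
    using that by (simp add: arc_def)
  have seg: "(vert n (bs 0 i) 0, vert n (bs 0 j) 0) \<in> edges ?G ^^ (j - i)"
    if "i \<le> j" "j \<le> ?m" for i j
    using that
  proof (induction j)
    case (Suc j)
    show ?case
    proof (cases "i = Suc j")
      case False
      with Suc have "(vert n (bs 0 i) 0, vert n (bs 0 j) 0) \<in> edges ?G ^^ (j - i)" by simp
      moreover have "(vert n (bs 0 j) 0, vert n (bs 0 (Suc j)) 0) \<in> edges ?G"
        using Suc.prems by (intro adj) (simp_all add: bs(1) kind_low kind_adj_def)
      ultimately have "(vert n (bs 0 i) 0, vert n (bs 0 (Suc j)) 0) \<in> edges ?G ^^ Suc (j - i)"
        by (rule relpow_Suc_I)
      then show ?thesis using False Suc.prems by (simp add: Suc_diff_le)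
    qed simp
  qed simp
  have xy: "?x = vert n (bs 0 0) 0" "?y = vert n (bs 0 ?m) 0"
    by (simp_all add: arm_end_def bs_def)
  have walk: "(?x, ?y) \<in> edges ?G ^^ (2 + C a)"
  proof (cases "e = 0")
    case True
    then show ?thesis using seg[of 0 ?m] e unfolding xy by (simp add: add.commute del: relpow.simps)
  next
    case False
    \<comment> \<open>The shortcut vertex is taken from stage \<open>s0\<close>, where the counter
      is at its limit; while the counter is higher, the kind is cut off below
      \<open>?m + e\<close>.\<close>
    have k: "kind n c (bs s0 (?m + e)) = ?m + e"
      using e by (simp add: bs s0)
    have "(vert n (bs 0 0) 0, vert n (bs s0 (?m + e)) 0) \<in> edges ?G"
      using False k by (intro adj) (simp_all add: kind_low bs(1) kind_adj_def)
    moreover have "(vert n (bs s0 (?m + e)) 0, vert n (bs 0 (e + 2)) 0) \<in> edges ?G"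
      using False e k by (intro adj') (simp_all add: kind_low bs(1) kind_adj_def)
    ultimately have "(?x, vert n (bs 0 (e + 2)) 0) \<in> edges ?G ^^ 2"
      unfolding xy numeral_2_eq_2 by auto
    from relpow_trans[OF this seg[of "e + 2" ?m]] e show ?thesis
      unfolding xy by simp
  qed
  \<comment> \<open>The lower bound comes from a 1-Lipschitz function \<open>\<phi>\<close>, the distance to \<open>?x\<close> cut off at \<open>m\<close>.\<close>
  define pk where "pk k = (if ?m < k then 1 else if k \<le> 1 then k else if k \<le> e + 2 then 2 else k - e)"
    for k
  define \<psi> where "\<psi> b = (if row b = a then pk (kind n c b) else ?m)" for b
  define \<phi> where "\<phi> v = (if v = 0 then ?L else min (\<psi> (base n v) + lev n v) (?m - lev n v))" for v
  \<comment> \<open>As the counter never falls below \<open>C a\<close>, row \<open>a\<close> has no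
    shortcut beyond \<open>?m + e\<close>.\<close>
  have kind_le: "kind n c b \<le> ?m + e" if "row b = a" for b
    using that countersD(1)[OF c, of a "fst (prod_decode (snd (prod_decode b)))"] e
    by (auto simp: kind_def pos_kind_def intro: min.coboundedI2)
  have pk_adj: "pk k' \<le> Suc (pk k) \<and> pk k \<le> Suc (pk k')"
    if "kind_adj n k k'" "k \<le> ?m + e" "k' \<le> ?m + e" for k k'
    using that e by (auto simp: kind_adj_def pk_def)
  have L: "?m = 2 * ?L - of_bool (odd n)"
    unfolding arm_len_def by (cases "even n") (auto elim!: evenE oddE)
  \<comment> \<open>Along an arm both arguments of \<open>min\<close> change by one. At a tip the
    second caps the value, so that it differs by at most one from that of the hub and, for odd
    \<open>n\<close>, from that of any other tip.\<close>
  have lip: "\<phi> v \<le> Suc (\<phi> u) \<and> \<phi> u \<le> Suc (\<phi> v)" if "arc n c u v" for u v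
  proof -
    consider "u = 0" "v \<noteq> 0" "Suc (lev n v) = ?L"
      | "u \<noteq> 0" "v \<noteq> 0" "odd n" "Suc (lev n u) = ?L" "Suc (lev n v) = ?L"
      | "u \<noteq> 0" "v \<noteq> 0" "base n u = base n v" "lev n v = Suc (lev n u)"
      | "u \<noteq> 0" "v \<noteq> 0" "lev n u = 0" "lev n v = 0" "row (base n u) = row (base n v)"
        "kind_adj n (kind n c (base n u)) (kind n c (base n v))"
      using \<open>arc n c u v\<close> unfolding arc_def by metis
    then show ?thesis
    proof cases
      case 1
      then show ?thesis using L by (cases "odd n") (auto simp: \<phi>_def)
    next
      case 2
      then show ?thesis using L by (auto simp: \<phi>_def)
    next
      case 3
      then show ?thesis by (auto simp: \<phi>_def)
    next
      case 4
      then have "\<psi> (base n v) \<le> Suc (\<psi> (base n u)) \<and> \<psi> (base n u) \<le> Suc (\<psi> (base n v))"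
        using pk_adj kind_le by (auto simp: \<psi>_def)
      with 4 show ?thesis by (auto simp: \<phi>_def)
    qed
  qed
  have lower: "2 + C a \<le> k" if "(?x, ?y) \<in> edges ?G ^^ k" for k
  proof -
    have "\<phi> ?y \<le> \<phi> ?x + k"
      using that by (rule relpow_potential[rotated]) (use lip in auto)
    moreover have "\<phi> ?x = 0" "\<phi> ?y = 2 + C a"
      using e kind_low[of 0 0] kind_low[of ?m 0] unfolding xy
      by (simp_all add: \<phi>_def \<psi>_def bs(1) pk_def Suc_diff_le)
    ultimately show ?thesis by simp
  qed
  show ?thesis
    using walk lower by (simp add: gdist_eq_Least del: relpow.simps) (rule Least_equality)
qed

section \<open>Distances depend on a finite signature\<close>

text \<open>Coding the data as a number makes it an index into a table of distances.\<close>

definition signature :: "nat \<Rightarrow> (nat \<Rightarrow> nat \<Rightarrow> nat) \<Rightarrow> (nat \<Rightarrow> nat) \<Rightarrow> nat \<Rightarrow> nat" where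
  "signature n c C v = (if v = 0 then 0 else
     Suc (prod_encode (lev n v, prod_encode (kind n c (base n v), C (row (base n v))))))"

text \<open>Equal bases lie in one row, so the last component, 0, 1 or 2, determines both
  flags.\<close>

definition pair_signature :: "nat \<Rightarrow> (nat \<Rightarrow> nat \<Rightarrow> nat) \<Rightarrow> (nat \<Rightarrow> nat) \<Rightarrow> nat \<Rightarrow> nat \<Rightarrow> nat" where
  "pair_signature n c C u v = prod_encode (signature n c C u, prod_encode (signature n c C v,
     of_bool (row (base n u) = row (base n v)) + of_bool (base n u = base n v)))"

text \<open>Levels, kinds and limits are bounded in terms of \<open>n\<close>, so one finite table
  serves all pairs of vertices.\<close>

lemma pair_signature_bounded:
  assumes "\<And>a. C a \<le> n"
  shows "\<exists>N. \<forall>u v. pair_signature n c C u v < N"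
proof -
  have "kind n c b \<le> 2 * n + 2" for b
    by (simp add: kind_def pos_kind_def min.coboundedI2)
  then have "signature n c C v \<in> insert 0 ((\<lambda>(i, k, l). Suc (prod_encode (i, prod_encode (k, l)))) `
      ({..arm_len n} \<times> {..2 * n + 2} \<times> {..n}))" (is "_ \<in> ?A") for v
    using assms less_imp_le[OF lev_less[of n v]]
    by (cases "v = 0") (force simp: signature_def image_iff)+
  then have "pair_signature n c C u v \<in> (\<lambda>(x, y, z). prod_encode (x, prod_encode (y, z))) ` (?A \<times> ?A \<times> {..2})"
    (is "_ \<in> ?B") for u v
    by (force simp: pair_signature_def image_iff of_bool_def)
  moreover have "finite ?B" by simp
  ultimately show ?thesis
    by (meson finite_nat_set_iff_bounded)
qed

text \<open>Equal signatures mean that some automorphism maps one pair of vertices to the other.\<close>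

lemma gdist_signature:
  assumes c: "counters n c C" and eq: "pair_signature n c C u v = pair_signature n c C u' v'"
  shows "gdist (arm_graph n c) u v = gdist (arm_graph n c) u' v'"
proof -
  have sig: "w = 0 \<and> w' = 0 \<or> w \<noteq> 0 \<and> w' \<noteq> 0 \<and> lev n w = lev n w' \<and>
      kind n c (base n w) = kind n c (base n w') \<and> C (row (base n w)) = C (row (base n w'))"
    if "signature n c C w = signature n c C w'" for w w'
    using that by (auto simp: signature_def split: if_splits)
  have flags: "row (base n u) = row (base n v) \<longleftrightarrow> row (base n u') = row (base n v')"
    "base n u = base n v \<longleftrightarrow> base n u' = base n v'"
    using eq by (auto simp: pair_signature_def of_bool_def split: if_splits)
  have u: "u = 0 \<and> u' = 0 \<or> u \<noteq> 0 \<and> u' \<noteq> 0 \<and> lev n u = lev n u' \<and>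
      kind n c (base n u) = kind n c (base n u') \<and> C (row (base n u)) = C (row (base n u'))"
    and v: "v = 0 \<and> v' = 0 \<or> v \<noteq> 0 \<and> v' \<noteq> 0 \<and> lev n v = lev n v' \<and>
      kind n c (base n v) = kind n c (base n v') \<and> C (row (base n v)) = C (row (base n v'))"
    by (rule sig, use eq in \<open>simp add: pair_signature_def\<close>)+
  have lift: "lift_base n \<beta> w = w'"
    if "w \<noteq> 0" "w' \<noteq> 0" "lev n w = lev n w'" "\<beta> (base n w) = base n w'" for \<beta> w w'
    using that by (simp add: lift_base_def vert_base_lev)
  consider "u = 0" "u' = 0" "v = 0" "v' = 0" | "u = 0" "u' = 0" "v \<noteq> 0" "v' \<noteq> 0"
    | "u \<noteq> 0" "u' \<noteq> 0" "v = 0" "v' = 0" | "u \<noteq> 0" "u' \<noteq> 0" "v \<noteq> 0" "v' \<noteq> 0"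
    using u v by blast
  then show ?thesis
  proof cases
    case 2
    \<comment> \<open>Every lift fixes the hub, so only one base has to be moved; it fills both
      places of \<open>gdist_homogeneous\<close>.\<close>
    obtain \<beta> where \<beta>: "\<beta> (base n v) = base n v'"
      "\<And>u v. gdist (arm_graph n c) (lift_base n \<beta> u) (lift_base n \<beta> v) = gdist (arm_graph n c) u v"
      by (rule gdist_homogeneous[OF c, of "base n v" "base n v'" "base n v" "base n v'"])
        (use 2 v in auto)
    from \<beta>(2)[of u v] 2 v lift[of v v' \<beta>] \<beta>(1) show ?thesis by simp
  next
    case 3
    obtain \<beta> where \<beta>: "\<beta> (base n u) = base n u'"
      "\<And>u v. gdist (arm_graph n c) (lift_base n \<beta> u) (lift_base n \<beta> v) = gdist (arm_graph n c) u v"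
      by (rule gdist_homogeneous[OF c, of "base n u" "base n u'" "base n u" "base n u'"])
        (use 3 u in auto)
    from \<beta>(2)[of u v] 3 u lift[of u u' \<beta>] \<beta>(1) show ?thesis by simp
  next
    case 4
    obtain \<beta> where \<beta>: "\<beta> (base n u) = base n u'" "\<beta> (base n v) = base n v'"
      "\<And>u v. gdist (arm_graph n c) (lift_base n \<beta> u) (lift_base n \<beta> v) = gdist (arm_graph n c) u v"
      by (rule gdist_homogeneous[OF c, of "base n u" "base n u'" "base n v" "base n v'"])
        (use 4 u v flags in auto)
    from \<beta>(3)[of u v] 4 u v lift[of u u' \<beta>] lift[of v v' \<beta>] \<beta>(1,2) show ?thesis by simp
  qed simp
qed

section \<open>Reductions\<close>

text \<open>Bit \<open>prod_encode (z, b)\<close> of a canonical index tells whether the pair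
  \<open>(z, b)\<close> is in the coded graph. A bound \<open>N\<close> on the value makes reading
  it off a finite sum.\<close>

definition lookup_bounded :: "nat \<Rightarrow> nat \<Rightarrow> nat \<Rightarrow> nat" where
  "lookup_bounded N r z = (\<Sum>b<Suc N. b * of_bool (odd (r div 2 ^ prod_encode (z, b))))"

lemma lookup_bounded_restr_code:
  assumes "finite D" "z \<in> D" "\<beta> z \<le> N"
  shows "lookup_bounded N (restr_code \<beta> D) z = \<beta> z"
proof -
  let ?A = "(\<lambda>a. prod_encode (a, \<beta> a)) ` D"
  have "odd (restr_code \<beta> D div 2 ^ prod_encode (z, b)) \<longleftrightarrow>
      prod_encode (z, b) \<in> set_decode (set_encode ?A)" for b
    by (simp add: restr_code_def set_decode_def)
  moreover have "prod_encode (z, b) \<in> set_decode (set_encode ?A) \<longleftrightarrow> b = \<beta> z" for b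
    using assms by (auto simp: set_encode_inverse)
  ultimately have "lookup_bounded N (restr_code \<beta> D) z = (\<Sum>b<Suc N. b * of_bool (b = \<beta> z))"
    by (simp add: lookup_bounded_def)
  also have "\<dots> = (\<Sum>b\<in>{\<beta> z}. b * of_bool (b = \<beta> z))"
    using assms(3) by (intro sum.mono_neutral_right) auto
  finally show ?thesis by simp
qed

lemma cf_lookup_bounded [cf_intros]:
  "cf k F \<Longrightarrow> cf k G \<Longrightarrow> cf k (\<lambda>e. lookup_bounded N (F e) (G e))"
  unfolding lookup_bounded_def by (intro cf_finite_sum cf_intros) simp_all

text \<open>Even rows follow the given counters; odd rows make every limit occur infinitely often.\<close>

definition padded :: "nat \<Rightarrow> (nat \<Rightarrow> nat) \<Rightarrow> nat \<Rightarrow> nat" where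
  "padded n h a = (if even a then h (a div 2) else (a div 2) mod Suc n)"

definition padded_countdown :: "nat \<Rightarrow> (nat \<Rightarrow> nat \<Rightarrow> nat) \<Rightarrow> nat \<Rightarrow> nat \<Rightarrow> nat" where
  "padded_countdown n g a s = padded n (\<lambda>x. countdown n g x s) a"

lemma countdown_le: "countdown n g x s \<le> n"
  by (induction s) auto

lemma decreasing_nat_eventually_const:
  fixes d :: "nat \<Rightarrow> nat"
  assumes "\<And>s. d (Suc s) \<le> d s"
  obtains l where "eventually (\<lambda>s. d s = l) sequentially" "\<And>s. l \<le> d s"
proof -
  define l where "l = (LEAST l. \<exists>s. d s = l)"
  have "\<exists>l s. d s = l" by blast
  then have "\<exists>s. d s = l" unfolding l_def by (rule LeastI_ex)
  then obtain s0 where s0: "d s0 = l" by blast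
  have le: "l \<le> d s" for s
    unfolding l_def by (rule Least_le) blast
  have "d s = l" if "s0 \<le> s" for s
    using lift_Suc_antimono_le[of d s0 s, OF assms that] le[of s] s0 by simp
  then have "eventually (\<lambda>s. d s = l) sequentially"
    unfolding eventually_sequentially by blast
  with le that show ?thesis by blast
qed

lemma lim_countdown:
  shows "eventually (\<lambda>s. countdown n g x s = lim (\<lambda>s. countdown n g x s)) sequentially"
    and "lim (\<lambda>s. countdown n g x s) \<le> countdown n g x s"
proof -
  obtain l where l: "eventually (\<lambda>s. countdown n g x s = l) sequentially"
    "\<And>s. l \<le> countdown n g x s"
    by (rule decreasing_nat_eventually_const[of "countdown n g x"]) auto
  have "lim (\<lambda>s. countdown n g x s) = l"
    using l(1) by (intro limI tendsto_eventually)
  with l show "eventually (\<lambda>s. countdown n g x s = lim (\<lambda>s. countdown n g x s)) sequentially"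
    "lim (\<lambda>s. countdown n g x s) \<le> countdown n g x s" by auto
qed

lemma counters_padded_countdown:
  "counters n (padded_countdown n g) (padded n (\<lambda>x. lim (\<lambda>s. countdown n g x s)))"
  unfolding counters_def
proof (intro conjI allI impI)
  fix k assume "k \<le> n"
  \<comment> \<open>The odd row \<open>2 * i + 1\<close> has limit \<open>i mod Suc n\<close>; here
    \<open>i = j * Suc n + k\<close>.\<close>
  have "inj (\<lambda>j. 2 * (j * Suc n + k) + 1)"
    by (simp add: inj_on_def del: mult_Suc_right)
  then have "infinite (range (\<lambda>j. 2 * (j * Suc n + k) + 1))"
    by (rule range_inj_infinite)
  moreover have "range (\<lambda>j. 2 * (j * Suc n + k) + 1) \<subseteq>
      {a. padded n (\<lambda>x. lim (\<lambda>s. countdown n g x s)) a = k}"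
    using \<open>k \<le> n\<close> by (auto simp: padded_def mod_mult_self3 simp del: mult_Suc_right)
  ultimately show "infinite {a. padded n (\<lambda>x. lim (\<lambda>s. countdown n g x s)) a = k}"
    using finite_subset by blast
next
  fix a
  show "eventually (\<lambda>s. padded_countdown n g a s = padded n (\<lambda>x. lim (\<lambda>s. countdown n g x s)) a) sequentially"
    using lim_countdown(1)[of n g "a div 2"] by (simp add: padded_countdown_def padded_def)
next
  fix a s
  show "padded n (\<lambda>x. lim (\<lambda>s. countdown n g x s)) a \<le> padded_countdown n g a s"
    using lim_countdown(2) by (simp add: padded_countdown_def padded_def)
  show "padded_countdown n g a s \<le> n"
    using countdown_le by (simp add: padded_countdown_def padded_def less_Suc_eq_le[symmetric])
qed

lemma computable_padded_countdown:
  assumes "computable2 g" shows "computable2 (padded_countdown n g)"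
proof -
  have eq: "countdown n g x s =
      rec_nat n (\<lambda>t y. if g x (Suc t) = g x t then y else y - 1) s" for x s
    by (induction s) auto
  have "cf 2 (\<lambda>e. padded_countdown n g (e 0) (e 1))"
    unfolding padded_countdown_def padded_def eq
    by (intro cf_intros cf_rec cf_comp2[OF assms]) simp_all
  then show ?thesis by (simp add: computable2_iff_cf)
qed

section \<open>The two reductions\<close>

lemma dist_fun_arm_graph:
  "dist_fun (arm_graph n c) x = gdist (arm_graph n c) (fst (prod_decode x)) (snd (prod_decode x))"
  by (simp add: dist_fun_def split_beta)

text \<open>A distance is determined by the signature of the pair. Levels and kinds are computable
  outright, and only the limits in the at most two rows call for values of \<open>h\<close>.\<close>

lemma btt_dist_fun_lim:
  assumes cc: "computable2 c" and c: "counters n c (padded n h)" and h: "\<And>x. h x \<le> n"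
  shows "btt_reducible 2 (dist_fun (arm_graph n c)) h"
proof -
  let ?G = "arm_graph n c" and ?C = "padded n h"
  obtain N where N: "\<And>u v. pair_signature n c ?C u v < N"
    using pair_signature_bounded[of ?C n c] countersD(3)[OF c] by blast
  \<comment> \<open>By \<open>gdist_signature\<close> any pair with signature \<open>k\<close> may
    represent it. The choice is not effective, but only the finitely many values below
    \<open>N\<close> enter the table.\<close>
  define T where "T k = (let (u, v) = (SOME (u, v). pair_signature n c ?C u v = k) in gdist ?G u v)" for k
  have T: "T (pair_signature n c ?C u v) = gdist ?G u v" for u v
  proof -
    let ?P = "\<lambda>(u', v'). pair_signature n c ?C u' v' = pair_signature n c ?C u v"
    obtain u' v' where some: "(SOME p. ?P p) = (u', v')" by fastforce
    have "?P (SOME p. ?P p)" by (rule someI[of ?P "(u, v)"]) simp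
    with some have "pair_signature n c ?C u' v' = pair_signature n c ?C u v" by simp
    from gdist_signature[OF c this] some show ?thesis by (simp add: T_def)
  qed
  define \<alpha> where "\<alpha> v = row (base n v) div 2" for v
  \<comment> \<open>The case distinction matters: for coinciding queries, adding the same power
    twice would be the index of another set.\<close>
  define p where "p x = (let u = fst (prod_decode x); v = snd (prod_decode x) in
    if \<alpha> u = \<alpha> v then 2 ^ \<alpha> u else 2 ^ \<alpha> u + 2 ^ \<alpha> v :: nat)" for x
  define S where "S x r = pair_signature n c (padded n (lookup_bounded n r))
    (fst (prod_decode x)) (snd (prod_decode x))" for x r
  \<comment> \<open>For arbitrary \<open>r\<close> the signature may fall outside the table; the
    default 0 keeps \<open>q\<close> total.\<close>
  define q where "q x r = (if S x r < N then T (S x r) else 0)" for x r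
  have D: "set_decode (p x) = {\<alpha> (fst (prod_decode x)), \<alpha> (snd (prod_decode x))}" for x
  proof -
    have "p x = set_encode {\<alpha> (fst (prod_decode x)), \<alpha> (snd (prod_decode x))}"
      by (simp add: p_def Let_def set_encode_def)
    then show ?thesis by (simp add: set_encode_inverse)
  qed
  have "computable1 p"
    unfolding computable1_iff_cf p_def Let_def \<alpha>_def row_def base_def
    by (intro cf_intros) simp_all
  moreover have "computable2 q"
    unfolding computable2_iff_cf q_def S_def pair_signature_def signature_def
      padded_def kind_def pos_kind_def row_def base_def lev_def
    by (intro cf_finite_table cf_intros cf_comp2[OF cc]) simp_all
  moreover have "card (set_decode (p x)) \<le> 2" for x
    unfolding D by (simp add: card_insert_if)
  moreover have "dist_fun ?G x = q x (restr_code h (set_decode (p x)))" for x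
  proof -
    let ?u = "fst (prod_decode x)" and ?v = "snd (prod_decode x)"
    let ?r = "restr_code h (set_decode (p x))"
    have "padded n (lookup_bounded n ?r) (row (base n w)) = ?C (row (base n w))" if "w \<in> {?u, ?v}" for w
      using that lookup_bounded_restr_code[of "set_decode (p x)" "\<alpha> w" h n] h
      by (auto simp: D padded_def \<alpha>_def)
    then have "S x ?r = pair_signature n c ?C ?u ?v"
      by (simp add: S_def pair_signature_def signature_def)
    then show ?thesis using N T by (simp add: q_def dist_fun_arm_graph)
  qed
  ultimately show ?thesis
    unfolding btt_reducible_def by blast
qed

text \<open>Row \<open>2 * x\<close> has limit \<open>h x\<close>, so the ends of its path are at
  distance \<open>2 + h x\<close> and one query suffices.\<close>

lemma btt_lim_dist_fun:
  assumes c: "counters n c (padded n h)" and h: "\<And>x. h x \<le> n"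
  shows "btt_reducible 1 h (dist_fun (arm_graph n c))"
proof -
  let ?G = "arm_graph n c"
  define z where "z x = prod_encode (arm_end n 0 (2 * x), arm_end n (n + 2) (2 * x))" for x
  define p :: "nat \<Rightarrow> nat" where "p x = 2 ^ z x" for x
  define q where "q x r = lookup_bounded (n + 2) r (z x) - 2" for x r
  have D: "set_decode (p x) = {z x}" for x
    using set_encode_inverse[of "{z x}"] by (simp add: p_def set_encode_def)
  have dist: "dist_fun ?G (z x) = h x + 2" for x
    using gdist_arm_ends[OF c, of "2 * x"] by (simp add: dist_fun_arm_graph z_def padded_def)
  have cz: "cf k (\<lambda>e. z (F e))" if "cf k F" for k F
    unfolding z_def arm_end_def vert_def by (intro cf_intros that)
  have "computable1 p"
    unfolding computable1_iff_cf p_def by (intro cf_intros cz) simp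
  moreover have "computable2 q"
    unfolding computable2_iff_cf q_def by (intro cf_intros cz) simp_all
  moreover have "card (set_decode (p x)) \<le> 1" for x
    by (simp add: D)
  moreover have "h x = q x (restr_code (dist_fun ?G) (set_decode (p x)))" for x
    using lookup_bounded_restr_code[of "{z x}" "z x" "dist_fun ?G" "n + 2"] h[of x]
    by (simp add: q_def D dist)
  ultimately show ?thesis
    unfolding btt_reducible_def by blast
qed

section \<open>Intrinsic approximability and the choice of the graphs\<close>

lemma verts_UNIV_of_iso:
  assumes "computable_graph H" "H \<cong>\<^sub>g G" "verts G = UNIV"
  shows "verts H = UNIV"
proof -
  obtain h where h: "bij_betw h (verts H) (verts G)"
    using assms(2) unfolding graph_iso_def by blast
  have "infinite (verts H)"
    using bij_betw_finite[OF h] assms(3) by simp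
  with assms(1) show ?thesis
    unfolding computable_graph_def by (metis finite_lessThan)
qed

theorem theorem5p5:
  fixes n :: nat
  shows "\<exists>G. computable_graph G \<and> connected_graph G \<and>
    intrinsically_approximable_from_above n G \<and>
    (\<forall>f g. approx_from_above n f g \<longrightarrow>
      (\<exists>H. computable_graph H \<and> H \<cong>\<^sub>g G \<and>
        btt_reducible 2 (dist_fun H) (\<lambda>x. lim (\<lambda>s. countdown n g x s)) \<and>
        btt_reducible 1 (\<lambda>x. lim (\<lambda>s. countdown n g x s)) (dist_fun H)))"
proof -
  \<comment> \<open>Any computable counters would serve: the odd rows provide every limit infinitely
    often, so \<open>counters_iso\<close> applies.\<close>
  define G where "G = arm_graph n (padded_countdown n (\<lambda>x s. 0))"
  have G: "computable_graph G" "verts G = UNIV" "diam_le (n + 2) G"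
    unfolding G_def
    by (intro computable_arm_graph computable_padded_countdown)
      (simp_all only: computable2_iff_cf cf_const arm_graph_simps diam_arm_graph)
  have conn: "connected_graph G"
    using G by (intro diam_le_connected) auto
  have intr: "intrinsically_approximable_from_above n G"
    unfolding intrinsically_approximable_from_above_def
  proof (intro allI impI, elim conjE)
    fix H assume H: "computable_graph H" "H \<cong>\<^sub>g G"
    then have "verts H = UNIV" using verts_UNIV_of_iso G(2) by blast
    moreover have "diam_le (n + 2) H"
      using diam_le_iso[OF graph_iso_sym[OF H(2)] _ G(3)] G(2) by simp
    ultimately show "approximable_from_above n (dist_fun H)"
      using H(1) by (intro diam_le_approximable)
  qed
  have "\<exists>H. computable_graph H \<and> H \<cong>\<^sub>g G \<and>
      btt_reducible 2 (dist_fun H) (\<lambda>x. lim (\<lambda>s. countdown n g x s)) \<and>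
      btt_reducible 1 (\<lambda>x. lim (\<lambda>s. countdown n g x s)) (dist_fun H)"
    if "approx_from_above n f g" for f g
  proof (intro exI conjI)
    let ?c = "padded_countdown n g"
    have comp: "computable2 ?c"
      using that by (intro computable_padded_countdown) (simp add: approx_from_above_def)
    have le: "lim (\<lambda>s. countdown n g x s) \<le> n" for x
      using lim_countdown(2) countdown_le by (rule order_trans)
    show "computable_graph (arm_graph n ?c)"
      using comp by (rule computable_arm_graph)
    show "arm_graph n ?c \<cong>\<^sub>g G"
      unfolding G_def by (rule counters_iso) (rule counters_padded_countdown)+
    show "btt_reducible 2 (dist_fun (arm_graph n ?c)) (\<lambda>x. lim (\<lambda>s. countdown n g x s))"
      using comp counters_padded_countdown le by (rule btt_dist_fun_lim)
    show "btt_reducible 1 (\<lambda>x. lim (\<lambda>s. countdown n g x s)) (dist_fun (arm_graph n ?c))"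
      using counters_padded_countdown le by (rule btt_lim_dist_fun)
  qed
  with G(1) conn intr show ?thesis by blast
qed

end
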